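(* Let $\mu$ be a measure or distribution and let $\Omega\subset\mathbf{C}$ be a solid domain with $0\in\Omega$ and $\Omega\in Q(\mu,AL^1)$. Suppose that $\mu$ has compact support in $\Omega$. Let $\varphi:\mathbf{D}\to\Omega$ be the conformal map normalized by $\varphi(0)=0$ and $\varphi'(0)>0$, and let $\nu$ be the pullback of $\mu$ to $\mathbf{D}$, i.e. $\nu(g)=\mu(g\circ\varphi^{-1})$ for $g\in AL^1(\mathbf{D})$. Then $\varphi$ satisfies the relation $$\varphi(z)=\nu_\lambda^*\left(\frac{z}{\overline{\varphi'(\lambda)}\,(1-z\bar{\lambda})}\right),\qquad z\in\mathbf{D},\qquad (\ast)$$ where $\nu_\lambda^*(g):=\overline{\nu_\lambda(\bar g)}$ acts on integrable anti-analytic functions $g(\lambda)$. Conversely, if $\varphi$ is any univalent solution on $\mathbf{D}$ to the relation $(\ast)$ (where $\nu$ denotes the pullback by $\varphi$ of a measure or distribution $\mu$ of compact support in $\varphi(\mathbf{D})$, i.e. $\mu$ is the push-forward of $\nu$), then the domain $\Omega=\varphi(\mathbf{D})$ is of class $Q(\mu,AL^1)$.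
   Context: $\mathbf{D}=\{z\in\mathbf{C}: |z|<1\}$ is the open unit disc. A domain is an open connected subset of $\mathbf{C}$; the exterior of $\Omega$ is $\Omega^e=\mathbf{C}\setminus\overline{\Omega}$. A bounded domain $\Omega$ is called solid if $\Omega^e$ is connected and $\partial\Omega=\partial(\Omega^e)$. The measure $dA(z)=\frac1\pi\,dx\,dy$ is normalized Lebesgue measure, $L^1(\Omega)$ is the space of functions integrable with respect to $dA$ on $\Omega$, and $AL^1(\Omega)$ is the subspace of holomorphic functions in $L^1(\Omega)$. Here $\mu$ is a (complex-linear) functional given by a fixed complex measure or distribution with compact support in $\Omega$; since its support is compact, it (and likewise its pullback $\nu$, which has compact support in $\mathbf{D}$) can be applied to every function holomorphic in $\Omega$ (respectively in $\mathbf{D}$). One writes $\Omega\in Q(\mu,AL^1)$ (and says that $\Omega$ is a quadrature domain with data $(\mu,AL^1)$) if $$\int_\Omega f\,dA=\mu(f)\qquad\text{for all } f\in AL^1(\Omega).$$ The subscript in $\nu_\lambda$ indicates that the functional acts with respect to the variable $\lambda\in\mathbf{D}$, with $z$ fixed. Univalent means holomorphic and injective. *)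

theory Defs
  imports "HOL-Complex_Analysis.Complex_Analysis"
begin

subsection \<open>Distributions on the plane\<close>

text \<open>The partial derivatives in \<open>x\<close> and \<open>y\<close> (real derivatives) are the directional derivatives
  along \<open>1\<close> and \<open>\<i>\<close>; \<open>frechet_derivative\<close> is real-linear.\<close>

definition dir_deriv :: "complex \<Rightarrow> (complex \<Rightarrow> complex) \<Rightarrow> complex \<Rightarrow> complex" where
  "dir_deriv v f = (\<lambda>z. frechet_derivative f (at z) v)"

definition mixed_partial :: "nat \<Rightarrow> nat \<Rightarrow> (complex \<Rightarrow> complex) \<Rightarrow> complex \<Rightarrow> complex" where
  "mixed_partial i j f = (dir_deriv 1 ^^ i) ((dir_deriv \<i> ^^ j) f)"

primrec Ck :: "nat \<Rightarrow> (complex \<Rightarrow> complex) \<Rightarrow> bool" where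
  "Ck 0 f \<longleftrightarrow> continuous_on UNIV f"
| "Ck (Suc k) f \<longleftrightarrow> (\<forall>z. f differentiable (at z)) \<and> (\<forall>v\<in>{1, \<i>}. Ck k (dir_deriv v f))"

definition fun_support :: "(complex \<Rightarrow> complex) \<Rightarrow> complex set" where
  "fun_support f = closure {z. f z \<noteq> 0}"

definition test_function :: "(complex \<Rightarrow> complex) \<Rightarrow> bool" where
  "test_function f \<longleftrightarrow> (\<forall>k. Ck k f) \<and> compact (fun_support f)"

text \<open>Only the values on test functions matter. Every supremum below is over a bounded set of
  reals, since the derivatives of a test function are continuous with compact support.\<close>

definition distribution :: "((complex \<Rightarrow> complex) \<Rightarrow> complex) \<Rightarrow> bool" where
  "distribution T \<longleftrightarrow>
     (\<forall>f g. test_function f \<longrightarrow> test_function g \<longrightarrow> T (\<lambda>z. f z + g z) = T f + T g) \<and>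
     (\<forall>c f. test_function f \<longrightarrow> T (\<lambda>z. c * f z) = c * T f) \<and>
     (\<forall>K. compact K \<longrightarrow>
        (\<exists>C N. \<forall>f. test_function f \<and> fun_support f \<subseteq> K \<longrightarrow>
           norm (T f) \<le> C * (\<Sum>(i, j)\<in>{(i, j). i + j \<le> N}. SUP z. norm (mixed_partial i j f z))))"

definition distribution_support :: "((complex \<Rightarrow> complex) \<Rightarrow> complex) \<Rightarrow> complex set" where
  "distribution_support T =
     - \<Union>{U. open U \<and> (\<forall>f. test_function f \<and> fun_support f \<subseteq> U \<longrightarrow> T f = 0)}"

text \<open>A distribution \<open>T\<close> with compact support in \<open>\<Omega>\<close> acts on functions defined only on \<open>\<Omega>\<close> by
  \<open>f \<mapsto> T (\<psi> f)\<close>, where the cut-off \<open>\<psi>\<close> is a test function supported in \<open>\<Omega>\<close> and equal to \<open>1\<close> near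
  the support of \<open>T\<close>. Such cut-offs exist and the value does not depend on the one chosen; the
  (arbitrary) values of \<open>f\<close> off \<open>\<Omega>\<close> are irrelevant because \<open>\<psi>\<close> vanishes there.\<close>

definition given_by_distribution :: "complex set \<Rightarrow> ((complex \<Rightarrow> complex) \<Rightarrow> complex) \<Rightarrow> bool" where
  "given_by_distribution \<Omega> \<mu> \<longleftrightarrow>
     (\<exists>T. distribution T \<and> compact (distribution_support T) \<and> distribution_support T \<subseteq> \<Omega> \<and>
       (\<exists>\<psi> U. test_function \<psi> \<and> fun_support \<psi> \<subseteq> \<Omega> \<and>
          open U \<and> distribution_support T \<subseteq> U \<and> (\<forall>z\<in>U. \<psi> z = 1) \<and>
          (\<forall>f. f holomorphic_on \<Omega> \<longrightarrow> \<mu> f = T (\<lambda>z. \<psi> z * f z))))"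

subsection \<open>Complex measures\<close>

text \<open>A complex Borel measure is represented by its polar decomposition \<open>h dM\<close>, with \<open>M\<close> its total
  variation (a finite positive Borel measure) and \<open>h\<close> unimodular; integration against it is
  \<open>f \<mapsto> \<integral> f h dM\<close>, and its support is that of \<open>M\<close>.\<close>

definition complex_measure :: "complex measure \<Rightarrow> (complex \<Rightarrow> complex) \<Rightarrow> bool" where
  "complex_measure M h \<longleftrightarrow>
     finite_measure M \<and> sets M = sets borel \<and> h \<in> borel_measurable borel \<and> (\<forall>z. norm (h z) = 1)"

definition measure_support :: "complex measure \<Rightarrow> complex set" where
  "measure_support M = - \<Union>{U. open U \<and> emeasure M U = 0}"

definition given_by_measure :: "complex set \<Rightarrow> ((complex \<Rightarrow> complex) \<Rightarrow> complex) \<Rightarrow> bool" where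
  "given_by_measure \<Omega> \<mu> \<longleftrightarrow>
     (\<exists>M h. complex_measure M h \<and> compact (measure_support M) \<and> measure_support M \<subseteq> \<Omega> \<and>
       (\<forall>f. f holomorphic_on \<Omega> \<longrightarrow> \<mu> f = (LINT z:measure_support M|M. f z * h z)))"

definition compactly_supported_functional ::
    "complex set \<Rightarrow> ((complex \<Rightarrow> complex) \<Rightarrow> complex) \<Rightarrow> bool" where
  "compactly_supported_functional \<Omega> \<mu> \<longleftrightarrow> given_by_measure \<Omega> \<mu> \<or> given_by_distribution \<Omega> \<mu>"

subsection \<open>Quadrature domains\<close>

abbreviation unit_disc :: "complex set" where
  "unit_disc \<equiv> ball 0 1"

definition complex_domain :: "complex set \<Rightarrow> bool" where
  "complex_domain \<Omega> \<longleftrightarrow> open \<Omega> \<and> connected \<Omega>"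

definition solid_domain :: "complex set \<Rightarrow> bool" where
  "solid_domain \<Omega> \<longleftrightarrow> complex_domain \<Omega> \<and> bounded \<Omega> \<and>
     connected (- closure \<Omega>) \<and> frontier \<Omega> = frontier (- closure \<Omega>)"

definition area :: "complex measure" where
  "area = density lborel (\<lambda>_. ennreal (1 / pi))"

definition AL1 :: "complex set \<Rightarrow> (complex \<Rightarrow> complex) set" where
  "AL1 \<Omega> = {f. f holomorphic_on \<Omega> \<and> set_integrable area \<Omega> f}"

definition quadrature_domain :: "complex set \<Rightarrow> ((complex \<Rightarrow> complex) \<Rightarrow> complex) \<Rightarrow> bool" where
  "quadrature_domain \<Omega> \<mu> \<longleftrightarrow> complex_domain \<Omega> \<and> (\<forall>f\<in>AL1 \<Omega>. (LINT z:\<Omega>|area. f z) = \<mu> f)"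

subsection \<open>Conformal maps and pullback of functionals\<close>

definition univalent_on :: "(complex \<Rightarrow> complex) \<Rightarrow> complex set \<Rightarrow> bool" where
  "univalent_on \<phi> S \<longleftrightarrow> \<phi> holomorphic_on S \<and> inj_on \<phi> S"

definition normalized_conformal_map :: "(complex \<Rightarrow> complex) \<Rightarrow> complex set \<Rightarrow> bool" where
  "normalized_conformal_map \<phi> \<Omega> \<longleftrightarrow> univalent_on \<phi> unit_disc \<and> \<phi> ` unit_disc = \<Omega> \<and>
     \<phi> 0 = 0 \<and> deriv \<phi> 0 \<in> \<real> \<and> Re (deriv \<phi> 0) > 0"

definition pullback ::
    "(complex \<Rightarrow> complex) \<Rightarrow> ((complex \<Rightarrow> complex) \<Rightarrow> complex) \<Rightarrow> (complex \<Rightarrow> complex) \<Rightarrow> complex" where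
  "pullback \<phi> \<mu> g = \<mu> (g \<circ> inv_into unit_disc \<phi>)"

definition conj_functional ::
    "((complex \<Rightarrow> complex) \<Rightarrow> complex) \<Rightarrow> (complex \<Rightarrow> complex) \<Rightarrow> complex" where
  "conj_functional \<nu> g = cnj (\<nu> (\<lambda>\<zeta>. cnj (g \<zeta>)))"

definition satisfies_relation ::
    "(complex \<Rightarrow> complex) \<Rightarrow> ((complex \<Rightarrow> complex) \<Rightarrow> complex) \<Rightarrow> bool" where
  "satisfies_relation \<phi> \<nu> \<longleftrightarrow>
     (\<forall>z\<in>unit_disc.
        \<phi> z = conj_functional \<nu> (\<lambda>\<zeta>. z / (cnj (deriv \<phi> \<zeta>) * (1 - z * cnj \<zeta>))))"

end

theory Submission
  imports Defs
begin

text \<open>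
  Put \<open>F = (f \<circ> \<phi>) * \<phi>'\<close> and let \<open>\<nu>\<close> be the pullback of \<open>\<mu>\<close>. The change of variables \<open>w = \<phi>(\<zeta>)\<close>
  has Jacobian \<open>\<bar>\<phi>'\<bar>\<^sup>2 = \<phi>' * cnj \<phi>'\<close>, so the area integral of \<open>f\<close> over \<open>\<Omega>\<close> is the integral of
  \<open>F * cnj \<phi>'\<close> over the unit disc, whereas \<open>\<mu>(f) = \<nu>(F / \<phi>')\<close>. The quadrature identity therefore says
  that \<open>F \<mapsto> \<nu>(F / \<phi>')\<close> is the area pairing with \<open>\<phi>'\<close>. On the kernels
  \<open>F(\<zeta>) = cnj z / (1 - cnj z * \<zeta>)\<close> that pairing has the value \<open>cnj (\<phi> z)\<close> if \<open>\<phi> 0 = 0\<close>: the relation is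
  nothing but the quadrature identity tested on these kernels.

  From the identity to the relation (\<open>quadrature_imp_relation\<close>), it only has to be seen that the
  kernels give admissible test functions: they are bounded, and \<open>\<phi>'\<close> is square integrable because
  \<open>\<Omega>\<close> has finite area.

  In the converse direction (\<open>relation_imp_quadrature\<close>), expanding the relation in powers of \<open>z\<close>
  gives \<open>\<phi> z = (\<Sum>n. cnj (c n) * z ^ (n+1))\<close> with \<open>c n = \<nu>(\<zeta> ^ n / \<phi>')\<close>, which is the identity for
  monomials \<open>F\<close>. A general \<open>F\<close> need not be integrable itself, only \<open>F * cnj \<phi>'\<close> is, so monomials are
  not summed over the whole disc. On the disc of radius \<open>r < 1\<close> all series converge uniformly, and
  orthogonality of the monomials (\<open>area_pairing_power_series\<close>) gives the integral of \<open>F * cnj \<phi>'\<close>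
  there as \<open>r\<^sup>2 * \<nu>(F(r\<^sup>2 * \<zeta>) / \<phi>'(\<zeta>))\<close>. As \<open>r\<close> tends to \<open>1\<close>, the integrals converge by dominated
  convergence and the values of \<open>\<nu>\<close> converge because \<open>\<nu>\<close> is continuous for locally uniform
  convergence.

  This continuity (\<open>compactly_continuous\<close>) is the one property of measures and distributions of
  compact support that is used. For a distribution it follows from its order estimate: the partial
  derivatives of a cut-off times a holomorphic \<open>f\<close> involve only complex derivatives of \<open>f\<close>, and
  those are controlled by values of \<open>f\<close> through the Cauchy inequalities.
\<close>

section \<open>Change of variables under univalent maps\<close>

text \<open>The substitution theorem speaks of vectors \<open>real ^ 'n\<close>, so complex numbers are moved to
  \<open>real ^ 2\<close> and back.\<close>

definition vec2 :: "complex \<Rightarrow> real^2" where "vec2 z = vector [Re z, Im z]"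
definition of_vec2 :: "real^2 \<Rightarrow> complex" where "of_vec2 v = Complex (v $ 1) (v $ 2)"

lemma vec2_inverse [simp]: "of_vec2 (vec2 z) = z" "vec2 (of_vec2 v) = v"
  by (auto simp: vec2_def of_vec2_def vec_eq_iff forall_2)

lemma linear_vec2: "linear vec2"
  by (rule linearI) (auto simp: vec2_def vec_eq_iff forall_2)

lemma linear_of_vec2: "linear of_vec2"
  by (rule linearI) (auto simp: of_vec2_def complex_eq_iff)

lemmas bounded_linear_vec2 = linear_vec2[THEN linear_conv_bounded_linear[THEN iffD1]]
lemmas bounded_linear_of_vec2 = linear_of_vec2[THEN linear_conv_bounded_linear[THEN iffD1]]

lemma of_vec2_measurable [measurable]: "of_vec2 \<in> borel_measurable borel"
  by (intro borel_measurable_continuous_onI linear_continuous_on bounded_linear_of_vec2)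

text \<open>Multiplication by \<open>c\<close> is a rotation followed by a dilation by \<open>norm c\<close>; this is where the Jacobian
  \<open>\<bar>g'\<bar>\<^sup>2\<close> comes from.\<close>

lemma det_complex_mult: "det (matrix (\<lambda>v. vec2 (c * of_vec2 v))) = (norm c)\<^sup>2"
  unfolding cmod_power2
  by (simp add: det_2 matrix_def axis_def vec2_def of_vec2_def power2_eq_square)

lemma distr_of_vec2: "distr lborel borel of_vec2 = lborel"
proof (rule lborel_eqI[symmetric])
  fix l u :: complex assume le: "\<And>b. b \<in> Basis \<Longrightarrow> l \<bullet> b \<le> u \<bullet> b"
  have B: "(Basis :: (real^2) set) = {axis 1 1, axis 2 1}" by (auto simp: Basis_vec_def UNIV_2)
  have "of_vec2 -` box l u = box (vec2 l) (vec2 u)"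
    by (auto simp: box_def Basis_complex_def of_vec2_def vec2_def Basis_vec_def inner_axis forall_2)
  moreover have "emeasure lborel (box (vec2 l) (vec2 u)) = (\<Prod>b\<in>Basis. (vec2 u - vec2 l) \<bullet> b)"
    using le[of 1] le[of \<i>]
    by (intro emeasure_lborel_box) (auto simp: vec2_def B inner_axis Basis_complex_def)
  moreover have "(\<Prod>b\<in>Basis. (vec2 u - vec2 l) \<bullet> b) = (\<Prod>b\<in>Basis. (u - l) \<bullet> b)"
  proof -
    have "axis 1 (1::real) \<noteq> (axis 2 1 :: real^2)" by (simp add: axis_eq_axis)
    then show ?thesis
      by (simp add: vec2_def B Basis_complex_def inner_axis)
  qed
  ultimately show "emeasure (distr lborel borel of_vec2) (box l u) = (\<Prod>b\<in>Basis. (u - l) \<bullet> b)"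
    by (simp add: emeasure_distr)
qed simp

lemma lborel_of_vec2:
  fixes F :: "complex \<Rightarrow> complex"
  assumes [measurable]: "F \<in> borel_measurable borel"
  shows "integrable lborel (\<lambda>v. F (of_vec2 v)) \<longleftrightarrow> integrable lborel F"
    and "integral\<^sup>L lborel (\<lambda>v. F (of_vec2 v)) = integral\<^sup>L lborel F"
proof -
  show "integrable lborel (\<lambda>v. F (of_vec2 v)) \<longleftrightarrow> integrable lborel F"
    using integrable_distr_eq[of of_vec2 lborel borel F] by (simp add: distr_of_vec2)
  show "integral\<^sup>L lborel (\<lambda>v. F (of_vec2 v)) = integral\<^sup>L lborel F"
    using integral_distr[of of_vec2 lborel borel F] by (simp add: distr_of_vec2)
qed

lemma integrable_vec2_iff:
  fixes F :: "'a \<Rightarrow> complex"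
  shows "integrable M (\<lambda>x. vec2 (F x)) \<longleftrightarrow> integrable M F"
proof
  assume "integrable M (\<lambda>x. vec2 (F x))"
  from integrable_bounded_linear[OF bounded_linear_of_vec2 this] show "integrable M F" by simp
qed (rule integrable_bounded_linear[OF bounded_linear_vec2])

text \<open>A bridge between Lebesgue integrals over the complex plane and the gauge integrals over
  \<open>real ^ 2\<close> in which the substitution theorem is phrased.\<close>

lemma lborel_absolutely_integrable_vec2:
  fixes f :: "complex \<Rightarrow> complex"
  assumes "open S" "continuous_on S f"
  defines "h \<equiv> \<lambda>v. vec2 (f (of_vec2 v))"
  shows "h absolutely_integrable_on (vec2 ` S) \<longleftrightarrow> set_integrable lborel S f"
    and "set_integrable lborel S f \<Longrightarrow> integral (vec2 ` S) h = vec2 (LINT z:S|lborel. f z)"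
proof -
  define F where "F = (\<lambda>z. indicator S z *\<^sub>R f z)"
  have F [measurable]: "F \<in> borel_measurable borel"
    unfolding F_def using assms by (intro borel_measurable_continuous_on_indicator) auto
  have vm: "vec2 \<in> borel_measurable borel"
    by (intro borel_measurable_continuous_onI linear_continuous_on bounded_linear_vec2)
  have img: "v \<in> vec2 ` S \<longleftrightarrow> of_vec2 v \<in> S" for v by (metis image_iff vec2_inverse)
  have eq: "indicator (vec2 ` S) v *\<^sub>R h v = vec2 (F (of_vec2 v))" for v
    using linear_vec2 by (auto simp: indicator_def img h_def F_def linear_0)
  have m: "(\<lambda>v. vec2 (F (of_vec2 v))) \<in> borel_measurable borel"
    using vm by measurable
  have 1: "h absolutely_integrable_on (vec2 ` S) \<longleftrightarrow> integrable lborel (\<lambda>v. vec2 (F (of_vec2 v)))"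
    unfolding set_integrable_def eq using m by (simp add: integrable_completion)
  show 2: "h absolutely_integrable_on (vec2 ` S) \<longleftrightarrow> set_integrable lborel S f"
    unfolding 1 integrable_vec2_iff lborel_of_vec2(1)[OF F] by (simp add: set_integrable_def F_def)
  assume "set_integrable lborel S f"
  with 2 have "h absolutely_integrable_on (vec2 ` S)" by simp
  then have "integral (vec2 ` S) h = (LINT v:vec2 ` S|lebesgue. h v)"
    by (rule set_lebesgue_integral_eq_integral(2)[symmetric])
  also have "\<dots> = (LINT v|lborel. vec2 (F (of_vec2 v)))"
    unfolding set_lebesgue_integral_def eq using m by (simp add: integral_completion)
  also have "\<dots> = vec2 (LINT v|lborel. F (of_vec2 v))"
    using \<open>set_integrable lborel S f\<close> lborel_of_vec2(1)[OF F]
    by (intro integral_bounded_linear[OF bounded_linear_vec2]) (simp add: set_integrable_def F_def)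
  also have "\<dots> = vec2 (LINT z:S|lborel. f z)"
    unfolding lborel_of_vec2(2)[OF F] by (simp add: set_lebesgue_integral_def F_def)
  finally show "integral (vec2 ` S) h = vec2 (LINT z:S|lborel. f z)" .
qed

lemma holomorphic_change_of_variables_lborel:
  fixes f g :: "complex \<Rightarrow> complex"
  assumes S: "open S" and g: "g holomorphic_on S" "inj_on g S" and f: "continuous_on (g ` S) f"
  defines "f' \<equiv> \<lambda>z. of_real ((norm (deriv g z))\<^sup>2) * f (g z)"
  shows "set_integrable lborel (g ` S) f \<longleftrightarrow> set_integrable lborel S f'"
    and "set_integrable lborel S f' \<Longrightarrow> (LINT z:g ` S|lborel. f z) = (LINT z:S|lborel. f' z)"
proof -
  define h where "h = (\<lambda>v. vec2 (g (of_vec2 v)))"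
  define h' where "h' = (\<lambda>v w. vec2 (deriv g (of_vec2 v) * of_vec2 w))"
  define k where "k = (\<lambda>v. vec2 (f (of_vec2 v)))"
  have ogS: "open (g ` S)" using open_mapping_thm3[OF g(1) S g(2)] .
  have contf': "continuous_on S f'"
    unfolding f'_def using holomorphic_on_imp_continuous_on[OF holomorphic_deriv[OF g(1) S]]
      continuous_on_compose2[OF f holomorphic_on_imp_continuous_on[OF g(1)]]
    by (intro continuous_intros) auto
  have oV: "open (vec2 ` S)"
  proof -
    have "vec2 ` S = of_vec2 -` S" by (auto, metis vec2_inverse(2) image_eqI)
    then show ?thesis
      using S linear_continuous_on[OF bounded_linear_of_vec2, of UNIV] by (simp add: open_vimage)
  qed
  have der: "(h has_derivative h' v) (at v within vec2 ` S)" if "v \<in> vec2 ` S" for v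
  proof -
    have "of_vec2 v \<in> S" using that by auto
    then have d: "(g has_derivative (*) (deriv g (of_vec2 v))) (at (of_vec2 v))"
      using holomorphic_derivI[OF g(1) S] by (simp add: has_field_derivative_def)
    have "(of_vec2 has_derivative of_vec2) (at v)"
      by (rule bounded_linear_imp_has_derivative[OF bounded_linear_of_vec2])
    from has_derivative_compose[OF this d]
    have "((\<lambda>x. g (of_vec2 x)) has_derivative (\<lambda>x. deriv g (of_vec2 v) * of_vec2 x)) (at v)" .
    from bounded_linear.has_derivative[OF bounded_linear_vec2 this]
    show ?thesis unfolding h_def h'_def by (rule has_derivative_at_withinI)
  qed
  have inj: "inj_on h (vec2 ` S)"
    using g(2) unfolding h_def inj_on_def by auto (metis vec2_inverse(1))
  have img: "h ` vec2 ` S = vec2 ` g ` S" by (auto simp: h_def image_iff)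
  have det: "\<bar>det (matrix (h' v))\<bar> *\<^sub>R k (h v) = vec2 (f' (of_vec2 v))" for v
    using linear_scale[OF linear_vec2, of "(norm (deriv g (of_vec2 v)))\<^sup>2" "f (g (of_vec2 v))"]
    by (simp add: h'_def det_complex_mult k_def h_def f'_def scaleR_conv_of_real)
  note cov = has_absolute_integral_change_of_variables[OF _ der inj, of k, unfolded img det]
  have SL: "vec2 ` S \<in> sets lebesgue" using oV by (simp add: borel_open)
  note cov = cov[OF SL]
  note t1 = lborel_absolutely_integrable_vec2[OF ogS f, folded k_def]
  note t2 = lborel_absolutely_integrable_vec2[OF S contf']
  show eq: "set_integrable lborel (g ` S) f \<longleftrightarrow> set_integrable lborel S f'"
    using cov t1(1) t2(1) by metis
  show "(LINT z:g ` S|lborel. f z) = (LINT z:S|lborel. f' z)" if "set_integrable lborel S f'"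
    using cov t1 t2 eq that by (metis vec2_inverse(1))
qed

lemma area_integral:
  fixes f :: "complex \<Rightarrow> 'b::{banach,second_countable_topology}"
  assumes "open S" "continuous_on S f"
  shows "set_integrable area S f \<longleftrightarrow> set_integrable lborel S f"
    and "(LINT z:S|area. f z) = (1 / pi) *\<^sub>R (LINT z:S|lborel. f z)"
proof -
  define F where "F = (\<lambda>z. indicator S z *\<^sub>R f z)"
  have F: "F \<in> borel_measurable lborel"
    unfolding F_def using borel_measurable_continuous_on_indicator[of S f] assms by auto
  have "integrable area F \<longleftrightarrow> integrable lborel (\<lambda>x. (1/pi) *\<^sub>R F x)"
    unfolding area_def using F by (intro integrable_density) auto
  also have "\<dots> \<longleftrightarrow> integrable lborel F"
    using integrable_scaleR_right[of pi lborel "\<lambda>x. (1/pi) *\<^sub>R F x"]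
      integrable_scaleR_right[of "1/pi" lborel F] by auto
  finally show "set_integrable area S f \<longleftrightarrow> set_integrable lborel S f"
    by (simp add: set_integrable_def F_def)
  have "integral\<^sup>L area F = integral\<^sup>L lborel (\<lambda>x. (1/pi) *\<^sub>R F x)"
    unfolding area_def using F by (intro integral_density) auto
  then show "(LINT z:S|area. f z) = (1 / pi) *\<^sub>R (LINT z:S|lborel. f z)"
    by (simp only: set_lebesgue_integral_def F_def integral_scaleR_right)
qed

lemma holomorphic_change_of_variables:
  fixes f g :: "complex \<Rightarrow> complex"
  assumes S: "open S" and g: "g holomorphic_on S" "inj_on g S" and f: "continuous_on (g ` S) f"
  defines "f' \<equiv> \<lambda>z. of_real ((norm (deriv g z))\<^sup>2) * f (g z)"
  shows "set_integrable area (g ` S) f \<longleftrightarrow> set_integrable area S f'"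
    and "set_integrable area S f' \<Longrightarrow> (LINT z:g ` S|area. f z) = (LINT z:S|area. f' z)"
proof -
  have ogS: "open (g ` S)" using open_mapping_thm3[OF g(1) S g(2)] .
  have contf': "continuous_on S f'"
    unfolding f'_def using holomorphic_on_imp_continuous_on[OF holomorphic_deriv[OF g(1) S]]
      continuous_on_compose2[OF f holomorphic_on_imp_continuous_on[OF g(1)]]
    by (intro continuous_intros) auto
  note cov = holomorphic_change_of_variables_lborel[OF S g f, folded f'_def]
  show "set_integrable area (g ` S) f \<longleftrightarrow> set_integrable area S f'"
    using area_integral[OF ogS f] area_integral[OF S contf'] cov by simp
  show "(LINT z:g ` S|area. f z) = (LINT z:S|area. f' z)" if "set_integrable area S f'"
    using area_integral[OF ogS f] area_integral[OF S contf'] cov that by simp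
qed

section \<open>Area pairing of power series on discs\<close>

lemma set_integrable_area_cball:
  fixes f :: "complex \<Rightarrow> 'b::{banach,second_countable_topology}"
  assumes "continuous_on (cball 0 r) f"
  shows "set_integrable area (ball 0 r) f"
proof -
  have "set_integrable lborel (cball 0 r) f"
    unfolding set_integrable_def by (rule borel_integrable_compact) (use assms in auto)
  then have "set_integrable lborel (ball 0 r) f"
    by (rule set_integrable_subset) auto
  moreover have "continuous_on (ball 0 r) f"
    using assms by (rule continuous_on_subset) auto
  ultimately show ?thesis by (simp add: area_integral)
qed

lemma area_ball_integral:
  assumes "r \<ge> 0"
  shows "(LINT z:ball 0 r|area. (1::real)) = r\<^sup>2"
proof -
  have "(LINT z:ball 0 r|area. (1::real)) = (1/pi) * (LINT z:ball (0::complex) r|lborel. (1::real))"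
    by (subst area_integral) auto
  also have "(LINT z:ball (0::complex) r|lborel. (1::real)) = measure lborel (ball (0::complex) r)"
    by (simp add: set_lebesgue_integral_def)
  also have "\<dots> = pi * r\<^sup>2"
    using assms by (simp add: content_ball unit_ball_vol_2 power2_eq_square)
  finally show ?thesis by simp
qed

lemma norm_area_ball_integral_le:
  fixes f :: "complex \<Rightarrow> complex"
  assumes f: "continuous_on (cball 0 r) f" and r: "r \<ge> 0"
    and bd: "\<And>z. z \<in> ball 0 r \<Longrightarrow> norm (f z) \<le> B"
  shows "norm (LINT z:ball 0 r|area. f z) \<le> B * r\<^sup>2"
proof -
  have "norm (LINT z:ball 0 r|area. f z) \<le> (LINT z:ball 0 r|area. norm (f z))"
    by (rule set_integral_norm_bound[OF set_integrable_area_cball[OF f]])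
  also have "\<dots> \<le> (LINT z:ball 0 r|area. B)"
    by (intro set_integral_mono set_integrable_area_cball continuous_on_norm f continuous_on_const bd)
  also have "\<dots> = (LINT z:ball 0 r|area. B * 1)" by simp
  also have "\<dots> = B * r\<^sup>2" by (simp only: set_integral_mult_right area_ball_integral[OF r])
  finally show ?thesis .
qed

lemma uniform_limit_area_integral:
  fixes h :: "nat \<Rightarrow> complex \<Rightarrow> complex"
  assumes u: "uniform_limit (cball 0 r) h H sequentially" and c: "\<And>n. continuous_on (cball 0 r) (h n)"
    and r: "r > 0"
  shows "(\<lambda>n. LINT z:ball 0 r|area. h n z) \<longlonglongrightarrow> (LINT z:ball 0 r|area. H z)"
proof (rule metric_LIMSEQ_I)
  have cH: "continuous_on (cball 0 r) H"
    by (rule uniform_limit_theorem[OF _ u]) (use c in auto)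
  fix e :: real assume "e > 0"
  then have "e / (2 * r\<^sup>2) > 0" using r by simp
  from uniform_limitD[OF u this] obtain N where N:
    "\<And>n z. n \<ge> N \<Longrightarrow> z \<in> cball 0 r \<Longrightarrow> dist (h n z) (H z) < e / (2 * r\<^sup>2)"
    unfolding eventually_sequentially by blast
  show "\<exists>no. \<forall>n\<ge>no. dist (LINT z:ball 0 r|area. h n z) (LINT z:ball 0 r|area. H z) < e"
  proof (intro exI allI impI)
    fix n assume "n \<ge> N"
    have "norm (LINT z:ball 0 r|area. h n z - H z) \<le> e / (2 * r\<^sup>2) * r\<^sup>2"
      using r N[OF \<open>n \<ge> N\<close>] c cH
      by (intro norm_area_ball_integral_le continuous_on_diff) (auto simp: dist_norm less_imp_le)
    also have "\<dots> < e" using r \<open>e > 0\<close> by simp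
    finally show "dist (LINT z:ball 0 r|area. h n z) (LINT z:ball 0 r|area. H z) < e"
      using c cH by (simp add: dist_norm set_integral_diff set_integrable_area_cball)
  qed
qed

text \<open>Used in two ways: rotations (\<open>c\<close> of modulus one) give the orthogonality of different monomials,
  and dilations (\<open>c\<close> positive) reduce the moments of a disc to those of the unit disc.\<close>

lemma area_ball_mult_substitution:
  fixes f :: "complex \<Rightarrow> complex"
  assumes c: "c \<noteq> 0" and f: "continuous_on (cball 0 (norm c * r)) f"
  shows "(LINT z:ball 0 (norm c * r)|area. f z) = of_real ((norm c)\<^sup>2) * (LINT z:ball 0 r|area. f (c * z))"
proof -
  have img: "(*) c ` ball 0 r = ball 0 (norm c * r)"
  proof
    show "ball 0 (norm c * r) \<subseteq> (*) c ` ball 0 r"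
      using c by (auto intro!: image_eqI[of _ _ "_ / c"] simp: norm_divide divide_less_eq mult.commute)
  qed (use c in \<open>auto simp: norm_mult\<close>)
  have fi: "set_integrable area (ball 0 (norm c * r)) f"
    using f by (rule set_integrable_area_cball)
  have fc: "continuous_on (ball 0 (norm c * r)) f" using f by (rule continuous_on_subset) auto
  have d: "deriv ((*) c) z = c" for z
    by (intro DERIV_imp_deriv) (auto intro!: derivative_eq_intros)
  have "(LINT z:(*) c ` ball 0 r|area. f z) = (LINT z:ball 0 r|area. of_real ((norm (deriv ((*) c) z))\<^sup>2) * f (c * z))"
    using fi fc c
    by (intro holomorphic_change_of_variables(2) holomorphic_change_of_variables(1)[THEN iffD1])
      (auto simp: img inj_on_def intro!: holomorphic_intros)
  then show ?thesis by (simp add: img d)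
qed

text \<open>By scaling, the moment \<open>J r\<close> over the disc of radius \<open>r\<close> is
  \<open>r ^ (2*n+2) * J 1\<close>; on the annulus between radii \<open>r\<close> and \<open>1\<close> the integrand lies between
  \<open>r ^ (2*n)\<close> and \<open>1\<close>. Dividing by the area \<open>1 - r\<^sup>2\<close> of the annulus and letting \<open>r\<close> tend to \<open>1\<close>
  leaves \<open>J 1 * (n + 1) = 1\<close>.\<close>

lemma area_moment_unit_disc:
  "(LINT z:ball 0 1|area. norm (z::complex) ^ (2*n)) = 1 / of_nat (Suc n)"
proof -
  define J where "J = (\<lambda>r. LINT z:ball 0 r|area. norm (z::complex) ^ (2*n))"
  have scale: "J r = r ^ (2*n+2) * J 1" if "r > 0" for r
  proof -
    have "complex_of_real (J r) = (LINT z:ball 0 (norm (of_real r :: complex) * 1)|area. complex_of_real (norm z ^ (2*n)))"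
      unfolding J_def set_integral_complex_of_real[symmetric] using that by simp
    also have "\<dots> = of_real (r\<^sup>2) * (LINT z:ball 0 1|area. complex_of_real (norm (of_real r * z) ^ (2*n)))"
      using that by (subst area_ball_mult_substitution) (auto intro!: continuous_intros)
    also have "(LINT z:ball 0 1|area. complex_of_real (norm (of_real r * z) ^ (2*n))) =
        (LINT z:ball 0 1|area. of_real (r ^ (2*n)) * complex_of_real (norm z ^ (2*n)))"
      using that by (simp add: norm_mult power_mult_distrib)
    also have "\<dots> = of_real (r ^ (2*n) * J 1)"
      by (simp only: set_integral_mult_right set_integral_complex_of_real J_def of_real_mult)
    finally have "complex_of_real (J r) = of_real (r\<^sup>2 * (r ^ (2*n) * J 1))" by simp
    then show ?thesis by (simp only: of_real_eq_iff) (simp add: power_add power2_eq_square)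
  qed
  have bounds: "r ^ (2*n) \<le> J 1 * (\<Sum>k<Suc n. (r\<^sup>2) ^ k) \<and> J 1 * (\<Sum>k<Suc n. (r\<^sup>2) ^ k) \<le> 1"
    if r: "0 < r" "r < 1" for r
  proof -
    have int: "set_integrable area (ball 0 s) (\<lambda>z::complex. norm z ^ (2*n))"
      "set_integrable area (ball 0 s) (\<lambda>z::complex. c :: real)" for s c
      by (intro set_integrable_area_cball continuous_intros)+
    define A where "A = ball (0::complex) 1 - ball 0 r"
    have A: "A \<in> sets area" by (simp add: A_def area_def)
    have dec: "(LINT z:ball 0 1|area. f z) = (LINT z:ball 0 r|area. f z) + (LINT z:A|area. f z)"
      and Aint: "set_integrable area A f"
      if "\<And>s. set_integrable area (ball 0 s) f" for f :: "complex \<Rightarrow> real"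
    proof -
      show *: "set_integrable area A f"
        using set_integrable_subset[OF that[of 1] A] by (auto simp: A_def)
      have "ball 0 1 = ball 0 r \<union> A" using r by (auto simp: A_def)
      then show "(LINT z:ball 0 1|area. f z) = (LINT z:ball 0 r|area. f z) + (LINT z:A|area. f z)"
        using set_integral_Un[of "ball 0 r" A area f] that[of r] * by (auto simp: A_def)
    qed
    have A1: "(LINT z:A|area. c) = c * (1 - r\<^sup>2)" for c :: real
    proof -
      have "(LINT z:A|area. (1::real)) = 1 - r\<^sup>2"
        using dec[OF int(2)[of _ 1]] area_ball_integral[of 1] area_ball_integral[of r] r by simp
      moreover have "(LINT z:A|area. c * 1) = c * (LINT z:A|area. 1)"
        by (rule set_integral_mult_right)
      ultimately show ?thesis by simp
    qed
    have J1: "J 1 - J r = (LINT z:A|area. norm z ^ (2*n))"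
      using dec[OF int(1)] unfolding J_def by linarith
    have "r ^ (2*n) * (1 - r\<^sup>2) \<le> J 1 - J r"
      unfolding J1 A1[symmetric] using r
      by (intro set_integral_mono Aint int) (auto simp: A_def intro!: power_mono)
    moreover have "J 1 - J r \<le> 1 * (1 - r\<^sup>2)"
      unfolding J1 A1[symmetric] using r
      by (intro set_integral_mono Aint int) (auto simp: A_def intro!: power_le_one)
    moreover have "J 1 - J r = J 1 * (\<Sum>k<Suc n. (r\<^sup>2) ^ k) * (1 - r\<^sup>2)"
    proof -
      have "J 1 - J r = J 1 * (1 - (r\<^sup>2) ^ Suc n)"
        unfolding scale[OF r(1)] power_mult[symmetric] by (simp add: right_diff_distrib)
      then show ?thesis unfolding one_diff_power_eq[of "r\<^sup>2" "Suc n"] by (simp only: mult_ac)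
    qed
    moreover have "1 - r\<^sup>2 > 0" using r by (simp add: abs_square_less_1)
    ultimately show ?thesis
      using mult_le_cancel_right_pos[of "1 - r\<^sup>2"] by simp
  qed
  have ev: "\<forall>\<^sub>F r in at_left (1::real). 0 < r \<and> r < 1"
    using eventually_at_left_real[of 0 1] by simp
  have lim: "((\<lambda>r. J 1 * (\<Sum>k<Suc n. (r\<^sup>2) ^ k)) \<longlongrightarrow> J 1 * (\<Sum>k<Suc n. (1\<^sup>2) ^ k)) (at_left 1)"
    "((\<lambda>r::real. r ^ (2*n)) \<longlongrightarrow> 1 ^ (2*n)) (at_left 1)"
    by (intro tendsto_intros)+
  have "J 1 * (\<Sum>k<Suc n. (1\<^sup>2) ^ k) \<le> 1"
    by (rule tendsto_upperbound[OF lim(1)]) (use ev bounds in \<open>auto elim!: eventually_mono\<close>)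
  moreover have "1 ^ (2*n) \<le> J 1 * (\<Sum>k<Suc n. (1\<^sup>2) ^ k)"
    by (rule tendsto_le[OF _ lim]) (use ev bounds in \<open>auto elim!: eventually_mono\<close>)
  ultimately have "J 1 * of_nat (Suc n) = 1" by simp
  then have "J 1 = 1 / of_nat (Suc n)" by (simp only: eq_divide_eq) simp
  then show ?thesis unfolding J_def .
qed

text \<open>For \<open>n \<noteq> m\<close> the substitution \<open>z \<mapsto> c * z\<close> with \<open>norm c = 1\<close> multiplies the integral by
  \<open>c ^ n * cnj c ^ m\<close>, so the integral vanishes as soon as this factor is not \<open>1\<close>.\<close>

lemma area_integral_monomials:
  assumes r: "r > 0"
  shows "(LINT z:ball 0 r|area. z ^ n * cnj z ^ m) =
    (if n = m then of_real (r ^ (2*n+2)) / of_nat (Suc n) else 0)"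
proof (cases "n = m")
  case True
  have "(LINT z:ball 0 r|area. z ^ n * cnj z ^ m) = (LINT z:ball 0 (norm (of_real r :: complex) * 1)|area. z ^ n * cnj z ^ n)"
    using r True by simp
  also have "\<dots> = of_real (r\<^sup>2) * (LINT z:ball 0 1|area. (of_real r * z) ^ n * cnj (of_real r * z) ^ n)"
    using r by (subst area_ball_mult_substitution) (auto intro!: continuous_intros)
  also have "(\<lambda>z. (of_real r * z) ^ n * cnj (of_real r * z) ^ n) = (\<lambda>z. of_real (r ^ (2*n)) * complex_of_real (norm z ^ (2*n)))"
  proof
    fix z
    have "(of_real r * z) ^ n * cnj (of_real r * z) ^ n = ((of_real r)\<^sup>2 * (z * cnj z)) ^ n"
      by (simp add: power_mult_distrib[symmetric] power2_eq_square mult_ac)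
    then show "(of_real r * z) ^ n * cnj (of_real r * z) ^ n = of_real (r ^ (2*n)) * complex_of_real (norm z ^ (2*n))"
      by (simp add: power_mult power_mult_distrib flip: complex_norm_square)
  qed
  also have "(LINT z:ball 0 1|area. of_real (r ^ (2*n)) * complex_of_real (norm z ^ (2*n))) = of_real (r ^ (2*n)) / of_nat (Suc n)"
    by (simp only: set_integral_mult_right set_integral_complex_of_real area_moment_unit_disc) simp
  finally show ?thesis using True by (simp add: power_add power2_eq_square)
next
  case False
  define k where "k = int n - int m"
  have "k \<noteq> 0" using False by (simp add: k_def)
  \<comment> \<open>The factor \<open>c ^ n * cnj c ^ m\<close> becomes \<open>cis 1\<close>.\<close>
  define c where "c = cis (1 / k)"
  have c: "norm c = 1" "c \<noteq> 0" by (auto simp: c_def)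
  have "(LINT z:ball 0 r|area. z ^ n * cnj z ^ m) = (LINT z:ball 0 (norm c * r)|area. z ^ n * cnj z ^ m)"
    using c by simp
  also have "\<dots> = (LINT z:ball 0 r|area. (c * z) ^ n * cnj (c * z) ^ m)"
    using c by (subst area_ball_mult_substitution) (auto intro!: continuous_intros)
  also have "(\<lambda>z. (c * z) ^ n * cnj (c * z) ^ m) = (\<lambda>z. (c ^ n * cnj c ^ m) * (z ^ n * cnj z ^ m))"
    by (simp add: fun_eq_iff power_mult_distrib)
  also have "c ^ n * cnj c ^ m = cis 1"
  proof -
    have "c ^ n * cnj c ^ m = cis (n * (1 / k) + m * (- (1 / k)))"
      by (simp only: c_def cis_cnj Complex.DeMoivre cis_mult)
    also have "n * (1 / k) + m * (- (1 / k)) = 1"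
    proof -
      have "real n * (1 / k) + real m * (- (1 / k)) = (real n - real m) / k" by (simp add: diff_divide_distrib)
      also have "real n - real m = k" by (simp add: k_def)
      finally show ?thesis using \<open>k \<noteq> 0\<close> by simp
    qed
    finally show ?thesis .
  qed
  finally have "(LINT z:ball 0 r|area. z ^ n * cnj z ^ m) = cis 1 * (LINT z:ball 0 r|area. z ^ n * cnj z ^ m)"
    by simp
  moreover have "cis 1 \<noteq> 1"
  proof
    assume "cis 1 = 1"
    then have "sin (1::real) = 0" by (simp add: complex_eq_iff)
    then show False using sin_gt_zero[of 1] pi_gt3 by simp
  qed
  ultimately show ?thesis using False by simp
qed

lemma power_series_uniform_limit:
  fixes a :: "nat \<Rightarrow> complex"
  assumes s: "\<And>z. norm z < 1 \<Longrightarrow> (\<lambda>n. a n * z ^ n) sums F z" and r: "r < 1"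
  shows "uniform_limit (cball 0 r) (\<lambda>N z. \<Sum>n<N. a n * z ^ n) F sequentially"
proof (cases "r < 0")
  case False
  define t where "t = (1 + r) / 2"
  have t: "r < t" "0 \<le> t" "t < 1" using r False by (auto simp: t_def)
  have "summable (\<lambda>n. a n * (of_real t) ^ n)"
    using s[of "of_real t"] t by (auto simp: sums_iff)
  from conv_radius_geI[OF this] have "conv_radius a \<ge> t" using t by simp
  then have "r < conv_radius a" using t by (meson ereal_less_le less_ereal.simps(1) order_less_le_trans)
  from powser_uniform_limit[OF this, of 0]
  have "uniform_limit (cball 0 r) (\<lambda>n x. \<Sum>i<n. a i * x ^ i) (\<lambda>x. \<Sum>i. a i * x ^ i) sequentially"
    by simp
  moreover have "(\<Sum>i. a i * x ^ i) = F x" if "x \<in> cball 0 r" for x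
    using s[of x] that r by (simp add: sums_iff)
  ultimately show ?thesis
    by (auto intro: uniform_limit_cong'[THEN iffD1, rotated 2])
qed simp

lemma uniform_limit_mult_bounded:
  fixes f :: "nat \<Rightarrow> complex \<Rightarrow> complex"
  assumes u: "uniform_limit K f F sequentially" and K: "compact K" and g: "continuous_on K g"
  shows "uniform_limit K (\<lambda>n z. f n z * g z) (\<lambda>z. F z * g z) sequentially"
proof -
  obtain B where B: "\<And>z. z \<in> K \<Longrightarrow> norm (g z) \<le> B"
    using compact_imp_bounded[OF compact_continuous_image[OF g K]] unfolding bounded_iff by auto
  show ?thesis
  proof (rule uniform_limitI)
    fix e :: real assume e: "e > 0"
    \<comment> \<open>The maximum with \<open>1\<close> keeps the bound positive, so that \<open>e\<close> can be divided by it.\<close>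
    define B' where "B' = max B 1"
    have B': "B' > 0" "\<And>z. z \<in> K \<Longrightarrow> norm (g z) \<le> B'" using B by (force simp: B'_def)+
    from e B' have "e / B' > 0" by simp
    from uniform_limitD[OF u this]
    show "\<forall>\<^sub>F n in sequentially. \<forall>z\<in>K. dist (f n z * g z) (F z * g z) < e"
    proof eventually_elim
      case (elim n)
      show ?case
      proof
        fix z assume z: "z \<in> K"
        have "dist (f n z * g z) (F z * g z) = dist (f n z) (F z) * norm (g z)"
          by (simp add: dist_norm norm_mult left_diff_distrib[symmetric])
        also have "\<dots> \<le> dist (f n z) (F z) * B'" using B'(2)[OF z] by (intro mult_left_mono) auto
        also have "\<dots> < e" using elim z B' by (simp add: field_simps)
        finally show "dist (f n z * g z) (F z * g z) < e" .
      qed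
    qed
  qed
qed

text \<open>Integrating one series at a time, first \<open>F\<close> against a fixed monomial and then \<open>cnj G\<close> against \<open>F\<close>,
  avoids a double series: each step needs only uniform convergence on the closed disc of radius \<open>r\<close>.\<close>

lemma area_pairing_power_series:
  fixes a b :: "nat \<Rightarrow> complex"
  assumes F: "\<And>z. norm z < 1 \<Longrightarrow> (\<lambda>n. a n * z ^ n) sums F z"
    and G: "\<And>z. norm z < 1 \<Longrightarrow> (\<lambda>n. b n * z ^ n) sums G z"
    and r: "0 < r" "r < 1"
  shows "(\<lambda>n. a n * cnj (b n) * of_real (r ^ (2*n+2)) / of_nat (Suc n)) sums
           (LINT z:ball 0 r|area. F z * cnj (G z))"
proof -
  note uF = power_series_uniform_limit[OF F r(2)] and uG = power_series_uniform_limit[OF G r(2)]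
  have cF: "continuous_on (cball 0 r) F"
    by (rule uniform_limit_theorem[OF _ uF]) (auto intro!: continuous_intros always_eventually)
  have int: "set_integrable area (ball 0 r) h" if "continuous_on (cball 0 r) h" for h :: "complex \<Rightarrow> complex"
    using that by (rule set_integrable_area_cball)
  have mono: "(LINT z:ball 0 r|area. F z * cnj z ^ m) = a m * of_real (r ^ (2*m+2)) / of_nat (Suc m)" for m
  proof -
    have "(\<lambda>N. LINT z:ball 0 r|area. (\<Sum>n<N. a n * z ^ n) * cnj z ^ m) \<longlonglongrightarrow> (LINT z:ball 0 r|area. F z * cnj z ^ m)"
      using r by (intro uniform_limit_area_integral uniform_limit_mult_bounded uF continuous_intros) auto
    moreover have "(LINT z:ball 0 r|area. (\<Sum>n<N. a n * z ^ n) * cnj z ^ m) = a m * of_real (r ^ (2*m+2)) / of_nat (Suc m)"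
      if "N > m" for N
    proof -
      have "(LINT z:ball 0 r|area. (\<Sum>n<N. a n * z ^ n) * cnj z ^ m) = (LINT z:ball 0 r|area. (\<Sum>n<N. a n * (z ^ n * cnj z ^ m)))"
        by (simp add: sum_distrib_right mult.assoc)
      also have "\<dots> = (\<Sum>n<N. LINT z:ball 0 r|area. a n * (z ^ n * cnj z ^ m))"
        unfolding set_lebesgue_integral_def scaleR_sum_right
        by (rule Bochner_Integration.integral_sum)
          (rule int[unfolded set_integrable_def], intro continuous_intros)
      also have "\<dots> = (\<Sum>n<N. if n = m then a m * of_real (r ^ (2*m+2)) / of_nat (Suc m) else 0)"
        by (intro sum.cong refl) (simp add: area_integral_monomials[OF r(1)] del: of_nat_Suc)
      finally show ?thesis using that by simp
    qed
    ultimately show ?thesis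
      by (intro LIMSEQ_unique[OF _ tendsto_eventually]) (auto intro!: eventually_sequentiallyI[of "Suc m"])
  qed
  have "uniform_limit (cball 0 r) (\<lambda>N z. cnj (\<Sum>n<N. b n * z ^ n)) (\<lambda>z. cnj (G z)) sequentially"
    using uG by (simp add: uniform_limit_iff dist_norm complex_cnj_diff[symmetric] del: cnj_sum complex_cnj_diff)
  from uniform_limit_mult_bounded[OF this _ cF]
  have "(\<lambda>N. LINT z:ball 0 r|area. cnj (\<Sum>n<N. b n * z ^ n) * F z) \<longlonglongrightarrow> (LINT z:ball 0 r|area. cnj (G z) * F z)"
    using r cF by (intro uniform_limit_area_integral) (auto intro!: continuous_intros)
  moreover have "(LINT z:ball 0 r|area. cnj (\<Sum>n<N. b n * z ^ n) * F z) = (\<Sum>n<N. a n * cnj (b n) * of_real (r ^ (2*n+2)) / of_nat (Suc n))" for N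
  proof -
    have "(LINT z:ball 0 r|area. cnj (\<Sum>n<N. b n * z ^ n) * F z) = (LINT z:ball 0 r|area. (\<Sum>n<N. cnj (b n) * (F z * cnj z ^ n)))"
      by (simp add: sum_distrib_left mult_ac)
    also have "\<dots> = (\<Sum>n<N. LINT z:ball 0 r|area. cnj (b n) * (F z * cnj z ^ n))"
      unfolding set_lebesgue_integral_def scaleR_sum_right
      by (rule Bochner_Integration.integral_sum)
        (rule int[unfolded set_integrable_def], intro continuous_intros cF)
    also have "\<dots> = (\<Sum>n<N. a n * cnj (b n) * of_real (r ^ (2*n+2)) / of_nat (Suc n))"
      by (intro sum.cong refl, simp only: set_integral_mult_right mono) (simp add: mult_ac del: of_nat_Suc)
    finally show ?thesis .
  qed
  ultimately show ?thesis by (simp add: sums_def mult.commute)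
qed

lemma area_integral_exhaust_disc:
  fixes f :: "complex \<Rightarrow> complex"
  assumes "set_integrable area (ball 0 1) f"
  shows "(\<lambda>k. LINT z:ball 0 (1 - 1 / (real k + 2))|area. f z) \<longlonglongrightarrow> (LINT z:ball 0 1|area. f z)"
proof -
  define A where "A = (\<lambda>k. ball (0::complex) (1 - 1 / (real k + 2)))"
  have "incseq A" unfolding A_def incseq_def by (auto intro!: divide_left_mono simp: field_simps subset_ball elim!: order_less_le_trans)
  moreover have "(\<Union>k. A k) = ball 0 1"
  proof
    show "ball 0 1 \<subseteq> (\<Union>k. A k)"
    proof
      fix z :: complex assume "z \<in> ball 0 1"
      then have "1 - norm z > 0" by simp
      then obtain k where "inverse (of_nat (Suc k)) < 1 - norm z" using reals_Archimedean by blast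
      moreover have "1 / (real k + 2) \<le> inverse (of_nat (Suc k))" by (simp add: field_simps)
      ultimately have "z \<in> A k" by (simp add: A_def)
      then show "z \<in> (\<Union>k. A k)" by blast
    qed
  qed (auto simp: A_def elim!: order_less_le_trans)
  moreover have "A k \<in> sets area" for k by (simp add: A_def area_def)
  ultimately show ?thesis
    using set_integral_cont_up[of A area f] assms unfolding A_def by simp
qed

section \<open>Functionals continuous for locally uniform convergence\<close>

text \<open>Continuity of a linear functional on the holomorphic functions on \<open>S\<close> for the topology of
  locally uniform convergence. Functions are compared only on a compact subset of \<open>S\<close>, so the
  values that a total function takes off \<open>S\<close> are immaterial.\<close>

definition compactly_continuous :: "complex set \<Rightarrow> ((complex \<Rightarrow> complex) \<Rightarrow> complex) \<Rightarrow> bool" where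
  "compactly_continuous S \<mu> \<longleftrightarrow>
     (\<forall>f g. f holomorphic_on S \<longrightarrow> g holomorphic_on S \<longrightarrow> \<mu> (\<lambda>z. f z + g z) = \<mu> f + \<mu> g) \<and>
     (\<forall>c f. f holomorphic_on S \<longrightarrow> \<mu> (\<lambda>z. c * f z) = c * \<mu> f) \<and>
     (\<exists>K C. compact K \<and> K \<subseteq> S \<and> 0 \<le> C \<and>
        (\<forall>f B. f holomorphic_on S \<longrightarrow> 0 \<le> B \<longrightarrow> (\<forall>z\<in>K. norm (f z) \<le> B) \<longrightarrow> norm (\<mu> f) \<le> C * B))"

lemma given_by_measure_compactly_continuous:
  assumes "given_by_measure S \<mu>"
  shows "compactly_continuous S \<mu>"
proof -
  obtain M h where Mh: "complex_measure M h" and K: "compact (measure_support M)" "measure_support M \<subseteq> S"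
    and \<mu>: "\<And>f. f holomorphic_on S \<Longrightarrow> \<mu> f = (LINT z:measure_support M|M. f z * h z)"
    using assms unfolding given_by_measure_def by blast
  define K where "K = measure_support M"
  have M: "finite_measure M" "sets M = sets borel" "h \<in> borel_measurable borel" "\<And>z. norm (h z) = 1"
    using Mh by (auto simp: complex_measure_def)
  have KM: "K \<in> sets M" using K M(2) by (simp add: K_def borel_compact)
  have bound: "set_integrable M K (\<lambda>z. f z * h z) \<and> (0 \<le> B \<longrightarrow> (\<forall>z\<in>K. norm (f z) \<le> B) \<longrightarrow>
      norm (LINT z:K|M. f z * h z) \<le> measure M K * B)" if f: "f holomorphic_on S" for f B
  proof -
    have cf: "continuous_on K f"
      using f K(2) by (auto simp: K_def intro: holomorphic_on_imp_continuous_on holomorphic_on_subset)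
    have ind: "(\<lambda>z. indicator K z *\<^sub>R f z) \<in> borel_measurable borel"
      using cf K by (intro borel_measurable_continuous_on_indicator) (auto simp: K_def borel_compact)
    have "(\<lambda>z. (indicator K z *\<^sub>R f z) * h z) \<in> borel_measurable borel"
      using ind M(3) by (rule borel_measurable_times)
    then have meas: "(\<lambda>z. indicator K z *\<^sub>R (f z * h z)) \<in> borel_measurable M"
      using M(2) by (simp cong: measurable_cong_sets)
    have int: "set_integrable M K (\<lambda>z. f z * h z)"
    proof -
      obtain B where B: "\<And>z. z \<in> K \<Longrightarrow> norm (f z) \<le> B"
        using compact_imp_bounded[OF compact_continuous_image[OF cf]] K(1) unfolding bounded_iff K_def by auto
      show ?thesis unfolding set_integrable_def
        by (rule finite_measure.integrable_const_bound[OF M(1) _ meas, of "max B 0"])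
          (use B M(4) in \<open>force intro!: AE_I2 simp: indicator_def norm_mult le_max_iff_disj\<close>)
    qed
    moreover have "norm (LINT z:K|M. f z * h z) \<le> measure M K * B" if "0 \<le> B" "\<forall>z\<in>K. norm (f z) \<le> B"
    proof -
      have "norm (LINT z:K|M. f z * h z) \<le> (LINT z:K|M. norm (f z * h z))"
        by (rule set_integral_norm_bound[OF int])
      also have "\<dots> \<le> (LINT z:K|M. B)"
      proof (rule set_integral_mono)
        show "set_integrable M K (\<lambda>z. norm (f z * h z))" using int by (rule set_integrable_norm)
        show "set_integrable M K (\<lambda>z. B)"
          unfolding set_integrable_def using KM M(1)
          by (intro integrable_scaleR_left integrable_real_indicator)
            (auto simp: finite_measure.emeasure_finite less_top[symmetric])
      qed (use that M(4) in \<open>simp add: norm_mult\<close>)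
      also have "\<dots> = measure M K * B" using KM by (simp add: set_lebesgue_integral_def)
      finally show ?thesis .
    qed
    ultimately show ?thesis by blast
  qed
  have int: "set_integrable M K (\<lambda>z. f z * h z)" if "f holomorphic_on S" for f
    using bound[OF that] by blast
  show ?thesis unfolding compactly_continuous_def
  proof (intro conjI allI impI exI)
    fix f g assume f: "f holomorphic_on S" and g: "g holomorphic_on S"
    show "\<mu> (\<lambda>z. f z + g z) = \<mu> f + \<mu> g"
      using int[OF f] int[OF g]
      by (simp add: \<mu> f g holomorphic_on_add distrib_right set_integral_add(2) flip: K_def)
  next
    fix c f assume f: "f holomorphic_on S"
    show "\<mu> (\<lambda>z. c * f z) = c * \<mu> f"
      using f by (simp add: \<mu> holomorphic_on_mult mult.assoc)
  next
    fix f B assume "f holomorphic_on S" "0 \<le> B" "\<forall>z\<in>K. norm (f z) \<le> B"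
    then show "norm (\<mu> f) \<le> measure M K * B"
      using bound[of f B] by (simp add: \<mu> flip: K_def)
  qed (use K in \<open>auto simp: K_def\<close>)
qed

section \<open>Distributions of compact support are continuous on holomorphic functions\<close>

definition smooth :: "(complex \<Rightarrow> complex) \<Rightarrow> bool" where "smooth f \<longleftrightarrow> (\<forall>k. Ck k f)"

lemma smooth_differentiable: "smooth f \<Longrightarrow> f differentiable (at z)"
  unfolding smooth_def by (metis Ck.simps(2))

lemma smooth_dir_deriv: "smooth f \<Longrightarrow> v \<in> {1, \<i>} \<Longrightarrow> smooth (dir_deriv v f)"
  unfolding smooth_def by (metis Ck.simps(2))

lemma dir_deriv_eq: "(f has_derivative f') (at z) \<Longrightarrow> dir_deriv v f z = f' v"
  unfolding dir_deriv_def by (metis frechet_derivative_at)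

lemma differentiable_frechet:
  "f differentiable (at z) \<Longrightarrow> (f has_derivative frechet_derivative f (at z)) (at z)"
  using frechet_derivative_works by blast

lemma dir_deriv_add:
  assumes "f differentiable (at z)" "g differentiable (at z)"
  shows "dir_deriv v (\<lambda>z. f z + g z) z = dir_deriv v f z + dir_deriv v g z"
  using has_derivative_add[OF assms[THEN differentiable_frechet]]
  by (subst dir_deriv_eq) (auto simp: dir_deriv_def)

lemma dir_deriv_cmult:
  assumes "f differentiable (at z)"
  shows "dir_deriv v (\<lambda>z. c * f z) z = c * dir_deriv v f z"
  using has_derivative_mult_right[OF assms[THEN differentiable_frechet], of c]
  by (subst dir_deriv_eq) (auto simp: dir_deriv_def)

lemma Ck_add: "Ck k f \<Longrightarrow> Ck k g \<Longrightarrow> Ck k (\<lambda>z. f z + g z)"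
proof (induction k arbitrary: f g)
  case (Suc k)
  then have "dir_deriv v (\<lambda>z. f z + g z) = (\<lambda>z. dir_deriv v f z + dir_deriv v g z)" for v
    by (intro ext dir_deriv_add) auto
  with Suc show ?case by auto
qed (auto intro: continuous_on_add)

lemma Ck_cmult: "Ck k f \<Longrightarrow> Ck k (\<lambda>z. c * f z)"
proof (induction k arbitrary: f)
  case (Suc k)
  then have "dir_deriv v (\<lambda>z. c * f z) = (\<lambda>z. c * dir_deriv v f z)" for v
    by (intro ext dir_deriv_cmult) auto
  with Suc show ?case by auto
qed (auto intro: continuous_on_mult)

lemma smooth_add: "smooth f \<Longrightarrow> smooth g \<Longrightarrow> smooth (\<lambda>z. f z + g z)"
  by (auto simp: smooth_def Ck_add)

lemma smooth_cmult: "smooth f \<Longrightarrow> smooth (\<lambda>z. c * f z)"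
  by (auto simp: smooth_def Ck_cmult)

lemma smooth_0: "smooth (\<lambda>z. 0)"
proof -
  have "dir_deriv v (\<lambda>z. 0) = (\<lambda>z. 0)" for v
    by (intro ext dir_deriv_eq[where f' = "\<lambda>_. 0"] has_derivative_const)
  then have "Ck k (\<lambda>z. 0)" for k
    by (induction k) auto
  then show ?thesis by (simp add: smooth_def)
qed

text \<open>The cut-offs below are functions of this class, with one and the same \<open>K\<close> for all their partial
  derivatives. The class is closed under \<open>dir_deriv\<close>, which makes inductions over the order of a
  mixed partial possible.\<close>

definition smooth_in :: "complex set \<Rightarrow> (complex \<Rightarrow> complex) \<Rightarrow> bool" where
  "smooth_in K f \<longleftrightarrow> smooth f \<and> (\<forall>z. z \<notin> K \<longrightarrow> f z = 0)"

lemma has_derivative_zero_outside: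
  assumes "closed K" "\<And>z. z \<notin> K \<Longrightarrow> f z = 0" "z \<notin> K"
  shows "(f has_derivative (\<lambda>_. 0)) (at z)"
proof (rule has_derivative_transform_within_open[of "\<lambda>_. 0"])
  show "open (- K)" using assms by (simp add: open_Compl)
qed (use assms in auto)

lemma smooth_in_dir_deriv:
  assumes "closed K" "smooth_in K f" "v \<in> {1, \<i>}"
  shows "smooth_in K (dir_deriv v f)"
  using assms has_derivative_zero_outside[of K f] dir_deriv_eq
  unfolding smooth_in_def by (metis smooth_dir_deriv)

lemma smooth_in_add: "smooth_in K f \<Longrightarrow> smooth_in K g \<Longrightarrow> smooth_in K (\<lambda>z. f z + g z)"
  by (auto simp: smooth_in_def smooth_add)

lemma smooth_in_cmult: "smooth_in K f \<Longrightarrow> smooth_in K (\<lambda>z. c * f z)"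
  by (auto simp: smooth_in_def smooth_cmult)

text \<open>The formula holds at every point, although \<open>f\<close> is arbitrary off \<open>S\<close>: off \<open>K\<close> the product vanishes
  in a neighbourhood, and so do both terms on the right.\<close>

lemma cutoff_product_derivative:
  assumes S: "open S" and K: "compact K" "K \<subseteq> S" and f: "f holomorphic_on S" and \<eta>: "smooth_in K \<eta>"
  shows "((\<lambda>z. \<eta> z * f z) has_derivative
    (\<lambda>v. frechet_derivative \<eta> (at z) v * f z + v * \<eta> z * deriv f z)) (at z)"
proof (cases "z \<in> S")
  case True
  have "(f has_derivative (*) (deriv f z)) (at z)"
    using holomorphic_derivI[OF f S True] by (simp add: has_field_derivative_def)
  from has_derivative_mult[OF differentiable_frechet[OF smooth_differentiable] this, of \<eta>] \<eta>
  show ?thesis by (simp add: smooth_in_def algebra_simps)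
next
  case False
  then have z: "z \<notin> K" using K by auto
  have cl: "closed K" using K by (simp add: compact_imp_closed)
  have "frechet_derivative \<eta> (at z) = (\<lambda>_. 0)"
    using has_derivative_zero_outside[OF cl _ z, of \<eta>] \<eta> frechet_derivative_at
    unfolding smooth_in_def by metis
  moreover have "((\<lambda>z. \<eta> z * f z) has_derivative (\<lambda>_. 0)) (at z)"
    using has_derivative_zero_outside[OF cl _ z, of "\<lambda>z. \<eta> z * f z"] \<eta> by (auto simp: smooth_in_def)
  ultimately show ?thesis using z \<eta> by (simp add: smooth_in_def)
qed

text \<open>If \<open>\<eta> j\<close> are the coefficients of \<open>f\<close>, \<open>f'\<close>, \<open>f''\<close>, ... in a linear differential operator, these are
  the coefficients after one more derivative in direction \<open>v\<close>. They do not depend on \<open>f\<close>, because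
  the derivative of the \<open>j\<close>-th complex derivative in direction \<open>v\<close> is \<open>v\<close> times the next one.\<close>

fun leibniz_coeff :: "complex \<Rightarrow> (nat \<Rightarrow> complex \<Rightarrow> complex) \<Rightarrow> nat \<Rightarrow> complex \<Rightarrow> complex" where
  "leibniz_coeff v \<eta> 0 = dir_deriv v (\<eta> 0)"
| "leibniz_coeff v \<eta> (Suc j) = (\<lambda>z. dir_deriv v (\<eta> (Suc j)) z + v * \<eta> j z)"

lemma smooth_in_leibniz_coeff:
  assumes "closed K" "\<And>j. smooth_in K (\<eta> j)" "v \<in> {1, \<i>}"
  shows "smooth_in K (leibniz_coeff v \<eta> j)"
  using assms by (cases j) (auto intro!: smooth_in_add smooth_in_cmult smooth_in_dir_deriv)

lemma cutoff_sum_derivative: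
  assumes S: "open S" and K: "compact K" "K \<subseteq> S" and f: "f holomorphic_on S"
    and \<eta>: "\<And>j. smooth_in K (\<eta> j)"
  shows "((\<lambda>z. \<Sum>j<m. \<eta> j z * (deriv ^^ j) f z) has_derivative
    (\<lambda>v. \<Sum>j<m. frechet_derivative (\<eta> j) (at z) v * (deriv ^^ j) f z + v * \<eta> j z * (deriv ^^ Suc j) f z)) (at z)"
proof (rule has_derivative_sum)
  fix j
  show "((\<lambda>z. \<eta> j z * (deriv ^^ j) f z) has_derivative
    (\<lambda>v. frechet_derivative (\<eta> j) (at z) v * (deriv ^^ j) f z + v * \<eta> j z * (deriv ^^ Suc j) f z)) (at z)"
    using cutoff_product_derivative[OF S K holomorphic_higher_deriv[OF f S] \<eta>] by simp
qed

lemma dir_deriv_cutoff_sum: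
  assumes S: "open S" and K: "compact K" "K \<subseteq> S" and f: "f holomorphic_on S"
    and \<eta>: "\<And>j. smooth_in K (\<eta> j)" and \<eta>0: "\<And>j. j \<ge> m \<Longrightarrow> \<eta> j = (\<lambda>_. 0)"
  shows "dir_deriv v (\<lambda>z. \<Sum>j<m. \<eta> j z * (deriv ^^ j) f z) =
     (\<lambda>z. \<Sum>j<Suc m. leibniz_coeff v \<eta> j z * (deriv ^^ j) f z)"
proof
  fix z
  have "dir_deriv v (\<lambda>z. \<Sum>j<m. \<eta> j z * (deriv ^^ j) f z) z =
      (\<Sum>j<m. dir_deriv v (\<eta> j) z * (deriv ^^ j) f z + v * \<eta> j z * (deriv ^^ Suc j) f z)"
    using dir_deriv_eq[OF cutoff_sum_derivative[OF S K f \<eta>]] by (simp add: dir_deriv_def)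
  also have "\<dots> = (\<Sum>j<m. dir_deriv v (\<eta> j) z * (deriv ^^ j) f z) + (\<Sum>j<m. v * \<eta> j z * (deriv ^^ Suc j) f z)"
    by (rule sum.distrib)
  also have "(\<Sum>j<m. dir_deriv v (\<eta> j) z * (deriv ^^ j) f z) = (\<Sum>j<Suc m. dir_deriv v (\<eta> j) z * (deriv ^^ j) f z)"
  proof -
    have "dir_deriv v (\<eta> m) z = 0"
      by (simp add: \<eta>0 dir_deriv_eq[where f' = "\<lambda>_. 0"])
    then show ?thesis by simp
  qed
  also have "\<dots> + (\<Sum>j<m. v * \<eta> j z * (deriv ^^ Suc j) f z) = (\<Sum>j<Suc m. leibniz_coeff v \<eta> j z * (deriv ^^ j) f z)"
    unfolding sum.lessThan_Suc_shift
    by (simp add: sum.distrib[symmetric] distrib_right)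
  finally show "dir_deriv v (\<lambda>z. \<Sum>j<m. \<eta> j z * (deriv ^^ j) f z) z =
     (\<Sum>j<Suc m. leibniz_coeff v \<eta> j z * (deriv ^^ j) f z)" .
qed

lemma leibniz_coeff_vanishes:
  assumes "\<And>j. j \<ge> m \<Longrightarrow> \<eta> j = (\<lambda>_. 0)" "j \<ge> Suc m"
  shows "leibniz_coeff v \<eta> j = (\<lambda>_. 0)"
proof -
  obtain i where i: "j = Suc i" "i \<ge> m" using assms(2) by (cases j) auto
  have "dir_deriv v (\<lambda>_. 0) = (\<lambda>_. 0)" by (intro ext dir_deriv_eq[where f' = "\<lambda>_. 0"]) simp
  then show ?thesis using i assms(1)[of i] assms(1)[of j] by simp
qed

lemma Ck_cutoff_sum:
  assumes S: "open S" and K: "compact K" "K \<subseteq> S" and f: "f holomorphic_on S"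
    and \<eta>: "\<And>j. smooth_in K (\<eta> j)" and \<eta>0: "\<And>j. j \<ge> m \<Longrightarrow> \<eta> j = (\<lambda>_. 0)"
  shows "Ck k (\<lambda>z. \<Sum>j<m. \<eta> j z * (deriv ^^ j) f z)"
  using \<eta> \<eta>0
proof (induction k arbitrary: m \<eta>)
  case 0
  show ?case unfolding Ck.simps
    by (intro continuous_at_imp_continuous_on ballI has_derivative_continuous[OF cutoff_sum_derivative[OF S K f 0(1)]])
next
  case (Suc k)
  show ?case unfolding Ck.simps
  proof (intro conjI ballI allI)
    fix z show "(\<lambda>z. \<Sum>j<m. \<eta> j z * (deriv ^^ j) f z) differentiable (at z)"
      using cutoff_sum_derivative[where \<eta>=\<eta>, OF S K f Suc.prems(1)] unfolding differentiable_def by blast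
  next
    fix v :: complex assume v: "v \<in> {1, \<i>}"
    have eq: "dir_deriv v (\<lambda>z. \<Sum>j<m. \<eta> j z * (deriv ^^ j) f z) =
        (\<lambda>z. \<Sum>j<Suc m. leibniz_coeff v \<eta> j z * (deriv ^^ j) f z)"
      by (rule dir_deriv_cutoff_sum[where \<eta>=\<eta>, OF S K f Suc.prems])
    show "Ck k (dir_deriv v (\<lambda>z. \<Sum>j<m. \<eta> j z * (deriv ^^ j) f z))"
      unfolding eq
    proof (rule Suc.IH)
      show "smooth_in K (leibniz_coeff v \<eta> j)" for j
        by (rule smooth_in_leibniz_coeff[OF compact_imp_closed[OF K(1)] Suc.prems(1) v])
      show "leibniz_coeff v \<eta> j = (\<lambda>_. 0)" if "j \<ge> Suc m" for j
        by (rule leibniz_coeff_vanishes[OF Suc.prems(2) that])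
    qed
  qed
qed

text \<open>Iterating the Leibniz rule: the coefficients \<open>\<eta>'\<close> are obtained once and serve all holomorphic \<open>f\<close>,
  which is what makes \<open>mixed_partial_cutoff_bound\<close> uniform in \<open>f\<close>.\<close>

lemma dir_deriv_iterate_cutoff:
  assumes S: "open S" and K: "compact K" "K \<subseteq> S"
    and \<eta>: "\<And>j. smooth_in K (\<eta> j)" and \<eta>0: "\<And>j. j \<ge> m \<Longrightarrow> \<eta> j = (\<lambda>_. 0)"
    and v: "v \<in> {1, \<i>}"
  obtains \<eta>' m' where "\<And>j. smooth_in K (\<eta>' j)" "\<And>j. j \<ge> m' \<Longrightarrow> \<eta>' j = (\<lambda>_. 0)"
    "\<And>f. f holomorphic_on S \<Longrightarrow> (dir_deriv v ^^ n) (\<lambda>z. \<Sum>j<m. \<eta> j z * (deriv ^^ j) f z) =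
       (\<lambda>z. \<Sum>j<m'. \<eta>' j z * (deriv ^^ j) f z)"
proof -
  have "\<exists>\<eta>' m'. (\<forall>j. smooth_in K (\<eta>' j)) \<and> (\<forall>j\<ge>m'. \<eta>' j = (\<lambda>_. 0)) \<and>
    (\<forall>f. f holomorphic_on S \<longrightarrow> (dir_deriv v ^^ n) (\<lambda>z. \<Sum>j<m. \<eta> j z * (deriv ^^ j) f z) =
       (\<lambda>z. \<Sum>j<m'. \<eta>' j z * (deriv ^^ j) f z))"
  proof (induction n)
    case 0
    show ?case using \<eta> \<eta>0 by (intro exI[of _ \<eta>] exI[of _ m]) auto
  next
    case (Suc n)
    then obtain \<eta>' m' where IH: "\<And>j. smooth_in K (\<eta>' j)" "\<And>j. j \<ge> m' \<Longrightarrow> \<eta>' j = (\<lambda>_. 0)"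
      "\<And>f. f holomorphic_on S \<Longrightarrow> (dir_deriv v ^^ n) (\<lambda>z. \<Sum>j<m. \<eta> j z * (deriv ^^ j) f z) =
       (\<lambda>z. \<Sum>j<m'. \<eta>' j z * (deriv ^^ j) f z)" by blast
    show ?case
    proof (intro exI conjI allI impI)
      show "smooth_in K (leibniz_coeff v \<eta>' j)" for j
        using smooth_in_leibniz_coeff[OF compact_imp_closed[OF K(1)] IH(1) v] .
      show "leibniz_coeff v \<eta>' j = (\<lambda>_. 0)" if "j \<ge> Suc m'" for j
        using leibniz_coeff_vanishes[OF IH(2) that] .
      show "(dir_deriv v ^^ Suc n) (\<lambda>z. \<Sum>j<m. \<eta> j z * (deriv ^^ j) f z) =
         (\<lambda>z. \<Sum>j<Suc m'. leibniz_coeff v \<eta>' j z * (deriv ^^ j) f z)" if f: "f holomorphic_on S" for f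
        unfolding funpow.simps comp_def IH(3)[OF f]
        by (rule dir_deriv_cutoff_sum[where \<eta>=\<eta>', OF S K f IH(1,2)])
    qed
  qed
  then show ?thesis using that by blast
qed

lemma compact_separation_cball:
  fixes S :: "complex set"
  assumes "open S" "compact K" "K \<subseteq> S"
  obtains d where "d > 0" "\<And>z. z \<in> K \<Longrightarrow> cball z d \<subseteq> S"
    "compact (\<Union>z\<in>K. cball z d)"
proof -
  obtain e where e: "e > 0" "(\<Union>x\<in>K. cball x e) \<subseteq> S"
    using compact_subset_open_imp_cball_epsilon_subset[OF assms(2,1,3)] by blast
  have "(\<Union>x\<in>K. cball x e) = {x + y | x y. x \<in> K \<and> y \<in> cball 0 e}"
    by (auto simp: dist_norm) (metis add_diff_cancel_left' diff_add_cancel norm_minus_commute add.commute)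
  then have "compact (\<Union>x\<in>K. cball x e)"
    using compact_sums[OF assms(2) compact_cball[of 0 e]] by simp
  with e show ?thesis using that by blast
qed

text \<open>A mixed partial of \<open>\<psi> * f\<close> is a sum of bounded cut-offs times complex derivatives of \<open>f\<close>, and on \<open>K\<close>
  the latter are bounded by the Cauchy inequality on discs of the fixed radius \<open>d\<close>.\<close>

lemma mixed_partial_cutoff_bound:
  assumes S: "open S" and K: "compact K" "K \<subseteq> S" and \<psi>: "smooth_in K \<psi>"
    and d: "d > 0" "\<And>z. z \<in> K \<Longrightarrow> cball z d \<subseteq> S"
  obtains A where "\<And>f B z. f holomorphic_on S \<Longrightarrow> 0 \<le> B \<Longrightarrow>
      (\<And>z. z \<in> (\<Union>z\<in>K. cball z d) \<Longrightarrow> norm (f z) \<le> B) \<Longrightarrow>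
      norm (mixed_partial p q (\<lambda>z. \<psi> z * f z) z) \<le> A * B"
proof -
  \<comment> \<open>The multiplier \<open>\<psi>\<close> alone is the differential operator whose only coefficient is that of \<open>f\<close> itself.\<close>
  define \<eta> where "\<eta> = (\<lambda>j::nat. if j = 0 then \<psi> else (\<lambda>_. 0))"
  have \<eta>: "smooth_in K (\<eta> j)" "j \<ge> 1 \<Longrightarrow> \<eta> j = (\<lambda>_. 0)" for j
    using \<psi> smooth_0 by (auto simp: \<eta>_def smooth_in_def)
  obtain \<eta>1 m1 where \<eta>1: "\<And>j. smooth_in K (\<eta>1 j)" "\<And>j. j \<ge> m1 \<Longrightarrow> \<eta>1 j = (\<lambda>_. 0)"
    "\<And>f. f holomorphic_on S \<Longrightarrow> (dir_deriv \<i> ^^ q) (\<lambda>z. \<Sum>j<1. \<eta> j z * (deriv ^^ j) f z) =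
       (\<lambda>z. \<Sum>j<m1. \<eta>1 j z * (deriv ^^ j) f z)"
    by (rule dir_deriv_iterate_cutoff[where \<eta>=\<eta> and m=1 and v=\<i> and n=q, OF S K \<eta>]) auto
  obtain \<eta>2 m2 where \<eta>2: "\<And>j. smooth_in K (\<eta>2 j)" "\<And>j. j \<ge> m2 \<Longrightarrow> \<eta>2 j = (\<lambda>_. 0)"
    "\<And>f. f holomorphic_on S \<Longrightarrow> (dir_deriv 1 ^^ p) (\<lambda>z. \<Sum>j<m1. \<eta>1 j z * (deriv ^^ j) f z) =
       (\<lambda>z. \<Sum>j<m2. \<eta>2 j z * (deriv ^^ j) f z)"
    by (rule dir_deriv_iterate_cutoff[where \<eta>=\<eta>1 and m=m1 and v=1 and n=p, OF S K \<eta>1(1,2)]) auto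
  have mp: "mixed_partial p q (\<lambda>z. \<psi> z * f z) = (\<lambda>z. \<Sum>j<m2. \<eta>2 j z * (deriv ^^ j) f z)"
    if "f holomorphic_on S" for f
    using \<eta>1(3)[OF that] \<eta>2(3)[OF that] by (simp add: mixed_partial_def \<eta>_def)
  have "\<exists>b. b \<ge> 0 \<and> (\<forall>z. norm (\<eta>2 j z) \<le> b)" for j
  proof -
    have "continuous_on K (\<eta>2 j)"
      using \<eta>2(1)[of j] Ck.simps(1) unfolding smooth_in_def smooth_def by (metis continuous_on_subset subset_UNIV)
    from compact_imp_bounded[OF compact_continuous_image[OF this K(1)]]
    obtain b where b: "\<And>z. z \<in> K \<Longrightarrow> norm (\<eta>2 j z) \<le> b" unfolding bounded_iff by auto
    have "norm (\<eta>2 j z) \<le> max b 0" for z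
      using b[of z] \<eta>2(1)[of j] by (cases "z \<in> K") (auto simp: smooth_in_def)
    then show ?thesis by (intro exI[of _ "max b 0"]) auto
  qed
  then obtain b where b: "\<And>j. b j \<ge> 0" "\<And>j z. norm (\<eta>2 j z) \<le> b j" by metis
  show ?thesis
  proof (rule that[of "\<Sum>j<m2. b j * (fact j / d ^ j)"])
    fix f B z assume f: "f holomorphic_on S" and B: "0 \<le> B" and bd: "\<And>z. z \<in> (\<Union>z\<in>K. cball z d) \<Longrightarrow> norm (f z) \<le> B"
      have "norm (\<eta>2 j z * (deriv ^^ j) f z) \<le> b j * (fact j / d ^ j) * B" for j
      proof (cases "z \<in> K")
        case True
        have "norm ((deriv ^^ j) f z) \<le> fact j * B / d ^ j"
        proof (rule Cauchy_inequality[OF _ _ d(1)])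
          show "f holomorphic_on ball z d" "continuous_on (cball z d) f"
            using d(2)[OF True] f holomorphic_on_subset holomorphic_on_imp_continuous_on
            by (meson ball_subset_cball order_trans)+
          show "norm (f x) \<le> B" if "norm (z - x) = d" for x
            using that True by (intro bd) (auto simp: dist_norm)
        qed
        then have "norm (\<eta>2 j z) * norm ((deriv ^^ j) f z) \<le> b j * (fact j * B / d ^ j)"
          using b by (intro mult_mono) auto
        then show ?thesis by (simp add: norm_mult)
      next
        case False
        then show ?thesis using \<eta>2(1)[of j] b(1)[of j] B d(1) by (simp add: smooth_in_def)
      qed
      then show "norm (mixed_partial p q (\<lambda>z. \<psi> z * f z) z) \<le> (\<Sum>j<m2. b j * (fact j / d ^ j)) * B"
        unfolding mp[OF f] sum_distrib_right by (intro order_trans[OF norm_sum] sum_mono)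
  qed
qed

lemma given_by_distribution_compactly_continuous:
  assumes S: "open S" and "given_by_distribution S \<mu>"
  shows "compactly_continuous S \<mu>"
proof -
  obtain T \<psi> where T: "distribution T" and \<psi>: "test_function \<psi>" "fun_support \<psi> \<subseteq> S"
    and \<mu>: "\<And>f. f holomorphic_on S \<Longrightarrow> \<mu> f = T (\<lambda>z. \<psi> z * f z)"
    using assms(2) unfolding given_by_distribution_def by blast
  define K where "K = fun_support \<psi>"
  have K: "compact K" "K \<subseteq> S" using \<psi> by (auto simp: K_def test_function_def)
  have \<psi>K: "smooth_in K \<psi>"
    using \<psi>(1) closure_subset[of "{z. \<psi> z \<noteq> 0}"]
    by (auto simp: smooth_in_def smooth_def test_function_def K_def fun_support_def)
  have supp: "fun_support (\<lambda>z. \<psi> z * f z) \<subseteq> K" for f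
    unfolding K_def fun_support_def by (intro closure_mono) auto
  have test: "test_function (\<lambda>z. \<psi> z * f z)" if "f holomorphic_on S" for f
  proof -
    define \<eta> where "\<eta> = (\<lambda>j::nat. if j = 0 then \<psi> else (\<lambda>_. 0))"
    have \<eta>: "smooth_in K (\<eta> j)" "j \<ge> 1 \<Longrightarrow> \<eta> j = (\<lambda>_. 0)" for j
      using \<psi>K smooth_0 by (auto simp: \<eta>_def smooth_in_def)
    have "Ck k (\<lambda>z. \<psi> z * f z)" for k
      using Ck_cutoff_sum[where \<eta>=\<eta> and m=1, OF S K that \<eta>, of k] by (simp add: \<eta>_def)
    moreover have "compact (fun_support (\<lambda>z. \<psi> z * f z))"
      using supp K(1) compact_Int_closed[of K "fun_support (\<lambda>z. \<psi> z * f z)"]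
      by (simp add: Int_absorb1 fun_support_def)
    ultimately show ?thesis by (simp add: test_function_def)
  qed
  obtain d where d: "d > 0" "\<And>z. z \<in> K \<Longrightarrow> cball z d \<subseteq> S" "compact (\<Union>z\<in>K. cball z d)"
    using compact_separation_cball[OF S K] by blast
  define K' where "K' = (\<Union>z\<in>K. cball z d)"
  from T K(1) obtain C N where CN: "\<And>f. test_function f \<Longrightarrow> fun_support f \<subseteq> K \<Longrightarrow>
      norm (T f) \<le> C * (\<Sum>(p, q)\<in>{(p, q). p + q \<le> N}. SUP z. norm (mixed_partial p q f z))"
    unfolding distribution_def by meson
  have "\<exists>A. \<forall>f B z. f holomorphic_on S \<longrightarrow> 0 \<le> B \<longrightarrow> (\<forall>z\<in>K'. norm (f z) \<le> B) \<longrightarrow>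
      norm (mixed_partial p q (\<lambda>z. \<psi> z * f z) z) \<le> A * B" for p q
    using mixed_partial_cutoff_bound[OF S K \<psi>K d(1,2), of p q] unfolding K'_def by metis
  then obtain A where A: "\<And>p q f B z. f holomorphic_on S \<Longrightarrow> 0 \<le> B \<Longrightarrow> \<forall>z\<in>K'. norm (f z) \<le> B \<Longrightarrow>
      norm (mixed_partial p q (\<lambda>z. \<psi> z * f z) z) \<le> A p q * B"
    by metis
  define A' where "A' = (\<Sum>(p, q)\<in>{(p, q). p + q \<le> N}. \<bar>A p q\<bar>)"
  have bound: "norm (\<mu> f) \<le> \<bar>C\<bar> * A' * B"
    if f: "f holomorphic_on S" and B: "0 \<le> B" "\<forall>z\<in>K'. norm (f z) \<le> B" for f B
  proof -
    let ?s = "\<lambda>(p, q). SUP z. norm (mixed_partial p q (\<lambda>z. \<psi> z * f z) z)"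
    have le: "sum ?s {(p, q). p + q \<le> N} \<le> A' * B"
      unfolding A'_def sum_distrib_right
    proof (intro sum_mono, clarify)
      fix p q
      have "A p q * B \<le> \<bar>A p q\<bar> * B" using B by (intro mult_right_mono) auto
      then show "(SUP z. norm (mixed_partial p q (\<lambda>z. \<psi> z * f z) z)) \<le> \<bar>A p q\<bar> * B"
        using A[OF f B, of p q] by (intro cSUP_least) (auto intro: order_trans)
    qed
    \<comment> \<open>Suprema of unbounded sets of reals are unspecified, so boundedness enters here as well.\<close>
    have nonneg: "0 \<le> sum ?s {(p, q). p + q \<le> N}"
    proof (intro sum_nonneg, clarify)
      fix p q
      have "norm (mixed_partial p q (\<lambda>z. \<psi> z * f z) 0) \<le> (SUP z. norm (mixed_partial p q (\<lambda>z. \<psi> z * f z) z))"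
        using A[OF f B, of p q] by (intro cSUP_upper bdd_aboveI2) auto
      then show "0 \<le> (SUP z. norm (mixed_partial p q (\<lambda>z. \<psi> z * f z) z))"
        using norm_ge_zero order_trans by blast
    qed
    have "norm (\<mu> f) \<le> C * sum ?s {(p, q). p + q \<le> N}"
      unfolding \<mu>[OF f] by (rule CN[OF test[OF f] supp])
    also have "\<dots> \<le> \<bar>C\<bar> * sum ?s {(p, q). p + q \<le> N}"
      using nonneg by (intro mult_right_mono) auto
    also have "\<dots> \<le> \<bar>C\<bar> * (A' * B)" using le by (intro mult_left_mono) auto
    finally show ?thesis by (simp add: mult.assoc)
  qed
  show ?thesis unfolding compactly_continuous_def
  proof (intro conjI allI impI)
    fix f g assume f: "f holomorphic_on S" and g: "g holomorphic_on S"
    have "\<mu> (\<lambda>z. f z + g z) = T (\<lambda>z. \<psi> z * f z + \<psi> z * g z)"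
      using f g by (simp add: \<mu> holomorphic_on_add distrib_left)
    also have "\<dots> = T (\<lambda>z. \<psi> z * f z) + T (\<lambda>z. \<psi> z * g z)"
      using T test[OF f] test[OF g] unfolding distribution_def by blast
    finally show "\<mu> (\<lambda>z. f z + g z) = \<mu> f + \<mu> g" using f g by (simp add: \<mu>)
  next
    fix c f assume f: "f holomorphic_on S"
    have "\<mu> (\<lambda>z. c * f z) = T (\<lambda>z. c * (\<psi> z * f z))"
      using f by (simp add: \<mu> holomorphic_on_mult mult.left_commute)
    also have "\<dots> = c * T (\<lambda>z. \<psi> z * f z)"
      using T test[OF f] unfolding distribution_def by blast
    finally show "\<mu> (\<lambda>z. c * f z) = c * \<mu> f" using f by (simp add: \<mu>)
  next
    show "\<exists>K C. compact K \<and> K \<subseteq> S \<and> 0 \<le> C \<and>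
        (\<forall>f B. f holomorphic_on S \<longrightarrow> 0 \<le> B \<longrightarrow> (\<forall>z\<in>K. norm (f z) \<le> B) \<longrightarrow> norm (\<mu> f) \<le> C * B)"
      using bound d A'_def
      by (intro exI[of _ K'] exI[of _ "\<bar>C\<bar> * A'"]) (auto simp: K'_def intro!: mult_nonneg_nonneg sum_nonneg)
  qed
qed

section \<open>Limits and power series under continuous functionals\<close>

lemma compact_subset_unit_disc:
  assumes "compact K" "K \<subseteq> unit_disc"
  obtains r where "0 < r" "r < 1" "K \<subseteq> cball 0 r"
proof (cases "K = {}")
  case True
  then show ?thesis using that[of "1/2"] by simp
next
  case False
  obtain x where x: "x \<in> K" "\<And>y. y \<in> K \<Longrightarrow> norm y \<le> norm x"
    using continuous_attains_sup[OF assms(1) False continuous_on_norm[OF continuous_on_id]] by auto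
  have "norm x < 1" using x(1) assms(2) by auto
  moreover have "norm y \<le> (1 + norm x) / 2" if "y \<in> K" for y
    using x(2)[OF that] \<open>norm x < 1\<close> by simp
  moreover have "0 < 1 + norm x" by (simp add: add_pos_nonneg)
  ultimately have "0 < (1 + norm x)/2" "(1 + norm x)/2 < 1" "K \<subseteq> cball 0 ((1 + norm x) / 2)"
    by auto
  then show ?thesis by (rule that)
qed

context
  fixes S \<mu> assumes cc: "compactly_continuous S \<mu>"
begin

lemma compactly_continuous_add: "f holomorphic_on S \<Longrightarrow> g holomorphic_on S \<Longrightarrow> \<mu> (\<lambda>z. f z + g z) = \<mu> f + \<mu> g"
  using cc unfolding compactly_continuous_def by blast

lemma compactly_continuous_cmult: "f holomorphic_on S \<Longrightarrow> \<mu> (\<lambda>z. c * f z) = c * \<mu> f"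
  using cc unfolding compactly_continuous_def by blast

lemma compactly_continuous_diff:
  assumes "f holomorphic_on S" "g holomorphic_on S"
  shows "\<mu> (\<lambda>z. f z - g z) = \<mu> f - \<mu> g"
  using compactly_continuous_add[OF assms(1) holomorphic_on_mult[OF holomorphic_on_const assms(2)], of "-1"]
    compactly_continuous_cmult[OF assms(2), of "-1"] by simp

lemma compactly_continuous_cong:
  assumes f: "f holomorphic_on S" and g: "g holomorphic_on S" and eq: "\<And>z. z \<in> S \<Longrightarrow> f z = g z"
  shows "\<mu> f = \<mu> g"
proof -
  obtain K C where KC: "K \<subseteq> S" "\<And>f B. f holomorphic_on S \<Longrightarrow> 0 \<le> B \<Longrightarrow> \<forall>z\<in>K. norm (f z) \<le> B \<Longrightarrow> norm (\<mu> f) \<le> C * B"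
    using cc unfolding compactly_continuous_def by blast
  have "norm (\<mu> (\<lambda>z. f z - g z)) \<le> C * 0"
    using KC(1) eq by (intro KC(2) holomorphic_on_diff f g) auto
  then show ?thesis by (simp add: compactly_continuous_diff[OF f g])
qed

lemma compactly_continuous_sum:
  assumes "\<And>n. h n holomorphic_on S"
  shows "\<mu> (\<lambda>z. \<Sum>n<N. a n * h n z) = (\<Sum>n<(N::nat). a n * \<mu> (h n))"
proof (induction N)
  case 0
  show ?case using compactly_continuous_cmult[of "\<lambda>_. 0" 0] by simp
next
  case (Suc N)
  then show ?case
    using assms by (simp add: compactly_continuous_add compactly_continuous_cmult holomorphic_on_sum holomorphic_on_mult)
qed

lemma compactly_continuous_tendsto:
  assumes h: "\<And>n. h n holomorphic_on S" and H: "H holomorphic_on S"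
    and u: "\<And>K. compact K \<Longrightarrow> K \<subseteq> S \<Longrightarrow> uniform_limit K h H sequentially"
  shows "(\<lambda>n. \<mu> (h n)) \<longlonglongrightarrow> \<mu> H"
proof (rule metric_LIMSEQ_I)
  obtain K C where K: "compact K" "K \<subseteq> S" and C: "0 \<le> C"
    "\<And>f B. f holomorphic_on S \<Longrightarrow> 0 \<le> B \<Longrightarrow> \<forall>z\<in>K. norm (f z) \<le> B \<Longrightarrow> norm (\<mu> f) \<le> C * B"
    using cc unfolding compactly_continuous_def by blast
  fix e :: real assume e: "e > 0"
  \<comment> \<open>The denominator \<open>C + 1\<close> is positive even if \<open>C = 0\<close>.\<close>
  define d where "d = e / (C + 1)"
  have d: "d > 0" using e C(1) by (simp add: d_def)
  from uniform_limitD[OF u[OF K] d] obtain N where N: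
    "\<And>n z. n \<ge> N \<Longrightarrow> z \<in> K \<Longrightarrow> dist (h n z) (H z) < d"
    unfolding eventually_sequentially by blast
  show "\<exists>no. \<forall>n\<ge>no. dist (\<mu> (h n)) (\<mu> H) < e"
  proof (intro exI allI impI)
    fix n assume "n \<ge> N"
    have "dist (\<mu> (h n)) (\<mu> H) = norm (\<mu> (\<lambda>z. h n z - H z))"
      by (simp add: dist_norm compactly_continuous_diff[OF h H])
    also have "\<dots> \<le> C * d"
      using N[OF \<open>n \<ge> N\<close>] d by (intro C(2) holomorphic_on_diff h H) (auto simp: dist_norm less_imp_le)
    also have "\<dots> < (C + 1) * d" using d by (intro mult_strict_right_mono) auto
    also have "\<dots> = e" using C(1) by (simp add: d_def)
    finally show "dist (\<mu> (h n)) (\<mu> H) < e" .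
  qed
qed

end

lemma uniform_limit_subset_cball:
  assumes K: "compact K" "K \<subseteq> unit_disc"
    and u: "\<And>r. 0 < r \<Longrightarrow> r < 1 \<Longrightarrow> uniform_limit (cball 0 r) h H F"
  shows "uniform_limit K h H F"
  using compact_subset_unit_disc[OF K] u uniform_limit_on_subset by metis

text \<open>With monomials times \<open>p\<close> as test functions, \<open>\<nu>\<close> may be applied term by term, since the Taylor
  series converges uniformly on compact subsets of the disc. Here \<open>p\<close> will be \<open>1 / \<phi>'\<close>.\<close>

lemma compactly_continuous_power_series:
  fixes a :: "nat \<Rightarrow> complex"
  assumes cc: "compactly_continuous unit_disc \<nu>" and p: "p holomorphic_on unit_disc"
    and F: "F holomorphic_on unit_disc" and s: "\<And>z. norm z < 1 \<Longrightarrow> (\<lambda>n. a n * z ^ n) sums F z"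
  shows "(\<lambda>n. a n * \<nu> (\<lambda>z. z ^ n * p z)) sums \<nu> (\<lambda>z. F z * p z)"
proof -
  have "(\<lambda>N. \<nu> (\<lambda>z. (\<Sum>n<N. a n * z ^ n) * p z)) \<longlonglongrightarrow> \<nu> (\<lambda>z. F z * p z)"
  proof (rule compactly_continuous_tendsto[OF cc])
    fix K :: "complex set" assume K: "compact K" "K \<subseteq> unit_disc"
    have "continuous_on K p"
      using p K(2) holomorphic_on_imp_continuous_on continuous_on_subset by blast
    moreover have "uniform_limit K (\<lambda>N z. \<Sum>n<N. a n * z ^ n) F sequentially"
      by (rule uniform_limit_subset_cball[OF K]) (rule power_series_uniform_limit[OF s])
    ultimately show "uniform_limit K (\<lambda>N z. (\<Sum>n<N. a n * z ^ n) * p z) (\<lambda>z. F z * p z) sequentially"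
      by (intro uniform_limit_mult_bounded K)
  qed (intro holomorphic_intros p F)+
  moreover have "\<nu> (\<lambda>z. (\<Sum>n<N. a n * z ^ n) * p z) = (\<Sum>n<N. a n * \<nu> (\<lambda>z. z ^ n * p z))" for N
    using compactly_continuous_sum[OF cc, of "\<lambda>n z. z ^ n * p z" a N] p
    by (simp add: sum_distrib_right mult.assoc holomorphic_on_mult holomorphic_on_power)
  ultimately show ?thesis by (simp add: sums_def)
qed

section \<open>Univalent maps of the disc\<close>

context
  fixes \<phi> assumes \<phi>: "univalent_on \<phi> unit_disc"
begin

lemma univalent_on_disc:
  shows "\<phi> holomorphic_on unit_disc" "inj_on \<phi> unit_disc"
    "deriv \<phi> holomorphic_on unit_disc" "\<And>z. z \<in> unit_disc \<Longrightarrow> deriv \<phi> z \<noteq> 0"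
    "open (\<phi> ` unit_disc)"
    "(\<lambda>z. 1 / deriv \<phi> z) holomorphic_on unit_disc"
proof -
  show *: "\<phi> holomorphic_on unit_disc" "inj_on \<phi> unit_disc" using \<phi> by (auto simp: univalent_on_def)
  show 1: "deriv \<phi> holomorphic_on unit_disc" using * by (intro holomorphic_deriv) auto
  show 2: "deriv \<phi> z \<noteq> 0" if "z \<in> unit_disc" for z
    using holomorphic_injective_imp_regular[OF *(1) _ *(2)] that by auto
  show "open (\<phi> ` unit_disc)" using open_mapping_thm3[OF *(1) _ *(2)] by simp
  show "(\<lambda>z. 1 / deriv \<phi> z) holomorphic_on unit_disc"
    using 2 by (intro holomorphic_intros 1) auto
qed

lemma holomorphic_inverse: "inv_into unit_disc \<phi> holomorphic_on \<phi> ` unit_disc"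
proof -
  obtain g where g: "g holomorphic_on \<phi> ` unit_disc" "\<And>z. z \<in> unit_disc \<Longrightarrow> g (\<phi> z) = z"
    using holomorphic_has_inverse[OF univalent_on_disc(1) open_ball univalent_on_disc(2)] by metis
  show ?thesis
    by (rule holomorphic_transform[OF g(1)]) (use g(2) univalent_on_disc(2) in \<open>auto simp: inv_into_f_f\<close>)
qed

lemma holomorphic_comp_inverse:
  assumes "g holomorphic_on unit_disc"
  shows "(g \<circ> inv_into unit_disc \<phi>) holomorphic_on \<phi> ` unit_disc"
proof (rule holomorphic_on_compose_gen[OF holomorphic_inverse assms])
  show "inv_into unit_disc \<phi> ` \<phi> ` unit_disc \<subseteq> unit_disc"
    by (rule image_subsetI) (rule inv_into_into)
qed

lemma compactly_continuous_pullback: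
  assumes cc: "compactly_continuous (\<phi> ` unit_disc) \<mu>"
  shows "compactly_continuous unit_disc (pullback \<phi> \<mu>)"
proof -
  obtain K C where K: "compact K" "K \<subseteq> \<phi> ` unit_disc" and C: "0 \<le> C"
    "\<And>f B. f holomorphic_on \<phi> ` unit_disc \<Longrightarrow> 0 \<le> B \<Longrightarrow> \<forall>z\<in>K. norm (f z) \<le> B \<Longrightarrow> norm (\<mu> f) \<le> C * B"
    using cc unfolding compactly_continuous_def by blast
  let ?i = "inv_into unit_disc \<phi>"
  show ?thesis unfolding compactly_continuous_def
  proof (intro conjI allI impI exI)
    fix f g assume "f holomorphic_on unit_disc" "g holomorphic_on unit_disc"
    then show "pullback \<phi> \<mu> (\<lambda>z. f z + g z) = pullback \<phi> \<mu> f + pullback \<phi> \<mu> g"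
      using compactly_continuous_add[OF cc holomorphic_comp_inverse holomorphic_comp_inverse, of f g]
      by (simp add: pullback_def comp_def)
  next
    fix c f assume "f holomorphic_on unit_disc"
    then show "pullback \<phi> \<mu> (\<lambda>z. c * f z) = c * pullback \<phi> \<mu> f"
      using compactly_continuous_cmult[OF cc holomorphic_comp_inverse, of f c]
      by (simp add: pullback_def comp_def)
  next
    show "compact (?i ` K)"
      using K holomorphic_on_imp_continuous_on[OF holomorphic_inverse]
      by (intro compact_continuous_image) (auto intro: continuous_on_subset)
    show "?i ` K \<subseteq> unit_disc"
    proof (rule image_subsetI)
      fix w assume "w \<in> K"
      then have "w \<in> \<phi> ` unit_disc" using K(2) by (rule rev_subsetD)
      then show "?i w \<in> unit_disc" by (rule inv_into_into)
    qed
  next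
    fix f B assume "f holomorphic_on unit_disc" "0 \<le> B" "\<forall>z\<in>?i ` K. norm (f z) \<le> B"
    then show "norm (pullback \<phi> \<mu> f) \<le> C * B"
      unfolding pullback_def by (intro C(2) holomorphic_comp_inverse) auto
  qed (rule C(1))
qed

text \<open>After conjugation \<open>\<nu>\<close> acts on a holomorphic function of \<open>\<zeta>\<close>, a Cauchy kernel times \<open>1 / \<phi>'\<close>,
  which can be expanded in powers of \<open>\<zeta>\<close>.\<close>

lemma satisfies_relation_iff:
  "satisfies_relation \<phi> \<nu> \<longleftrightarrow>
    (\<forall>z\<in>unit_disc. cnj (\<phi> z) = \<nu> (\<lambda>\<zeta>. cnj z / (1 - cnj z * \<zeta>) * (1 / deriv \<phi> \<zeta>)))"
proof -
  have ker: "(\<lambda>\<zeta>. cnj (z / (cnj (deriv \<phi> \<zeta>) * (1 - z * cnj \<zeta>)))) =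
      (\<lambda>\<zeta>. cnj z / (1 - cnj z * \<zeta>) * (1 / deriv \<phi> \<zeta>))" for z
  proof
    fix \<zeta>
    have "cnj (z / (cnj (deriv \<phi> \<zeta>) * (1 - z * cnj \<zeta>))) = cnj z / (deriv \<phi> \<zeta> * (1 - cnj z * \<zeta>))"
      by simp
    also have "\<dots> = cnj z / (1 - cnj z * \<zeta>) * (1 / deriv \<phi> \<zeta>)"
      by simp
    finally show "cnj (z / (cnj (deriv \<phi> \<zeta>) * (1 - z * cnj \<zeta>))) =
        cnj z / (1 - cnj z * \<zeta>) * (1 / deriv \<phi> \<zeta>)" .
  qed
  have "w = cnj X \<longleftrightarrow> cnj w = X" for w X :: complex by auto
  then show ?thesis
    unfolding satisfies_relation_def conj_functional_def ker by blast
qed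

text \<open>The substitution \<open>w = \<phi> z\<close>, with one factor of the Jacobian \<open>\<phi>' * cnj \<phi>'\<close> absorbed into the
  holomorphic factor \<open>F\<close>.\<close>

lemma area_pairing_transform:
  fixes f F
  assumes f: "continuous_on (\<phi> ` unit_disc) f" and F: "\<And>z. z \<in> unit_disc \<Longrightarrow> F z = f (\<phi> z) * deriv \<phi> z"
  shows "set_integrable area (\<phi> ` unit_disc) f \<longleftrightarrow> set_integrable area unit_disc (\<lambda>z. F z * cnj (deriv \<phi> z))"
    and "set_integrable area unit_disc (\<lambda>z. F z * cnj (deriv \<phi> z)) \<Longrightarrow>
      (LINT z:\<phi> ` unit_disc|area. f z) = (LINT z:unit_disc|area. F z * cnj (deriv \<phi> z))"
proof -
  have sets: "unit_disc \<in> sets area" by (simp add: area_def)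
  have eq: "of_real ((norm (deriv \<phi> z))\<^sup>2) * f (\<phi> z) = F z * cnj (deriv \<phi> z)" if "z \<in> unit_disc" for z
    unfolding F[OF that] complex_norm_square by (simp add: mult_ac)
  note cov = holomorphic_change_of_variables[OF open_ball univalent_on_disc(1,2) f]
  have 1: "set_integrable area unit_disc (\<lambda>z. of_real ((norm (deriv \<phi> z))\<^sup>2) * f (\<phi> z)) \<longleftrightarrow>
      set_integrable area unit_disc (\<lambda>z. F z * cnj (deriv \<phi> z))"
    by (rule set_integrable_cong[OF refl refl eq])
  have 2: "(LINT z:unit_disc|area. of_real ((norm (deriv \<phi> z))\<^sup>2) * f (\<phi> z)) =
      (LINT z:unit_disc|area. F z * cnj (deriv \<phi> z))"
    by (rule set_lebesgue_integral_cong[OF sets]) (use eq in blast)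
  show "set_integrable area (\<phi> ` unit_disc) f \<longleftrightarrow> set_integrable area unit_disc (\<lambda>z. F z * cnj (deriv \<phi> z))"
    using cov(1) 1 by simp
  show "(LINT z:\<phi> ` unit_disc|area. f z) = (LINT z:unit_disc|area. F z * cnj (deriv \<phi> z))"
    if "set_integrable area unit_disc (\<lambda>z. F z * cnj (deriv \<phi> z))"
    using cov(2) 1 2 that by simp
qed

end

section \<open>The relation and the quadrature identity\<close>

text \<open>Differentiating \<open>\<phi>\<close> produces the factor \<open>n + 1\<close> that cancels the denominator in the moments of the
  disc, so that the pairing with \<open>\<phi>'\<close> sees the plain coefficients of \<open>\<phi>\<close>.\<close>

lemma area_pairing_deriv:
  assumes F: "\<And>z. norm z < 1 \<Longrightarrow> (\<lambda>n. b n * z ^ n) sums F z"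
    and \<phi>: "\<And>z. norm z < 1 \<Longrightarrow> (\<lambda>n. a n * z ^ n) sums \<phi> z" and r: "0 < r" "r < 1"
  shows "(\<lambda>n. b n * cnj (a (Suc n)) * of_real (r\<^sup>2) ^ Suc n) sums
    (LINT z:ball 0 r|area. F z * cnj (deriv \<phi> z))"
proof -
  have d: "(\<lambda>n. diffs a n * z ^ n) sums deriv \<phi> z" if z: "norm z < 1" for z
  proof -
    have sm: "summable (\<lambda>n. a n * x ^ n)" if "norm x < 1" for x
      using \<phi>[OF that] by (rule sums_summable)
    have "((\<lambda>z. \<Sum>n. a n * z ^ n) has_field_derivative (\<Sum>n. diffs a n * z ^ n)) (at z)"
      using z by (intro termdiffs_strong'[of 1]) (auto intro: sm)
    moreover have "eventually (\<lambda>w. w \<in> unit_disc) (nhds z)"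
      using z by (intro eventually_nhds_in_open) auto
    then have "eventually (\<lambda>w. (\<Sum>n. a n * w ^ n) = \<phi> w) (nhds z)"
      by eventually_elim (use \<phi> in \<open>auto simp: sums_iff\<close>)
    ultimately have "(\<phi> has_field_derivative (\<Sum>n. diffs a n * z ^ n)) (at z)"
      by (subst (asm) DERIV_cong_ev) auto
    then have "deriv \<phi> z = (\<Sum>n. diffs a n * z ^ n)" by (rule DERIV_imp_deriv)
    moreover have "summable (\<lambda>n. diffs a n * z ^ n)"
      using termdiff_converges[of z 1 a] z sm by auto
    ultimately show ?thesis by (simp add: sums_iff)
  qed
  have "(\<lambda>n. b n * cnj (diffs a n) * of_real (r ^ (2*n+2)) / of_nat (Suc n)) =
      (\<lambda>n. b n * cnj (a (Suc n)) * of_real (r\<^sup>2) ^ Suc n)"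
  proof
    fix n
    have "r ^ (2*n+2) = (r\<^sup>2) ^ Suc n" unfolding power_mult[symmetric] by simp
    then show "b n * cnj (diffs a n) * of_real (r ^ (2*n+2)) / of_nat (Suc n) =
        b n * cnj (a (Suc n)) * of_real (r\<^sup>2) ^ Suc n"
      by (simp add: diffs_def del: of_nat_Suc power_Suc)
  qed
  with area_pairing_power_series[OF F d r] show ?thesis by simp
qed

definition exhaust_radius :: "nat \<Rightarrow> real" where "exhaust_radius k = 1 - 1 / (real k + 2)"

lemma exhaust_radius: "0 < exhaust_radius k" "exhaust_radius k < 1" "exhaust_radius \<longlonglongrightarrow> 1"
proof -
  show "0 < exhaust_radius k" "exhaust_radius k < 1" by (auto simp: exhaust_radius_def field_simps)
  have "(\<lambda>k. 1 - 1 / (real k + 2)) \<longlonglongrightarrow> 1 - 0"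
    by (intro tendsto_intros) real_asymp
  then show "exhaust_radius \<longlonglongrightarrow> 1" unfolding exhaust_radius_def[abs_def] by simp
qed

lemma norm_dilation_le: "norm (of_real ((exhaust_radius k)\<^sup>2) * w) \<le> norm (w :: complex)"
proof -
  have "\<bar>(exhaust_radius k)\<^sup>2\<bar> * norm w \<le> 1 * norm w"
    using exhaust_radius(1,2)[of k] by (intro mult_right_mono) (auto simp: power_le_one)
  then show ?thesis by (simp only: norm_mult norm_of_real mult_1_left)
qed

lemma cauchy_kernel_sums:
  fixes z w :: complex assumes "norm z < 1" "norm w < 1"
  shows "(\<lambda>n. z ^ Suc n * w ^ n) sums (z / (1 - z * w))"
proof -
  have "norm (z * w) < 1" using assms by (simp add: norm_mult) (metis mult_strict_mono' norm_ge_zero mult_1)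
  from sums_mult[OF geometric_sums[OF this], of z]
  show ?thesis by (simp add: power_mult_distrib mult.assoc)
qed

lemma one_minus_mult_nonzero:
  fixes z w :: complex assumes "norm z < 1" "norm w < 1" shows "1 - z * w \<noteq> 0"
proof
  assume "1 - z * w = 0"
  then have "norm (z * w) = 1" by (metis eq_iff_diff_eq_0 norm_one)
  moreover have "norm z * norm w < 1 * 1" using assms by (intro mult_strict_mono') auto
  ultimately show False by (simp add: norm_mult)
qed

text \<open>On the disc of radius \<open>r\<close> the pairing of the kernel with \<open>\<phi>'\<close> is exactly \<open>cnj (\<phi> (r\<^sup>2 * z))\<close>, which
  tends to \<open>cnj (\<phi> z)\<close>. The condition \<open>\<phi> 0 = 0\<close> enters because the derivative \<open>\<phi>'\<close> has lost the
  constant term of \<open>\<phi>\<close>.\<close>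

lemma quadrature_imp_relation:
  assumes bdd: "bounded (\<phi> ` unit_disc)" and q: "quadrature_domain (\<phi> ` unit_disc) \<mu>"
    and \<phi>: "univalent_on \<phi> unit_disc" and 0: "\<phi> 0 = 0"
  shows "satisfies_relation \<phi> (pullback \<phi> \<mu>)"
  unfolding satisfies_relation_iff[OF \<phi>]
proof
  fix z assume z: "z \<in> unit_disc"
  note uf = univalent_on_disc[OF \<phi>]
  define F where "F = (\<lambda>\<zeta>. cnj z / (1 - cnj z * \<zeta>))"
  define f where "f = (\<lambda>\<zeta>. F \<zeta> * (1 / deriv \<phi> \<zeta>)) \<circ> inv_into unit_disc \<phi>"
  have nz: "1 - cnj z * \<zeta> \<noteq> 0" if "\<zeta> \<in> unit_disc" for \<zeta>
    using one_minus_mult_nonzero[of "cnj z" \<zeta>] z that by simp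
  have Fhol: "F holomorphic_on unit_disc"
    unfolding F_def using nz by (intro holomorphic_intros) auto
  have fhol: "f holomorphic_on \<phi> ` unit_disc"
    unfolding f_def by (intro holomorphic_comp_inverse[OF \<phi>] holomorphic_on_mult Fhol uf)
  have F_f: "F \<zeta> = f (\<phi> \<zeta>) * deriv \<phi> \<zeta>" if "\<zeta> \<in> unit_disc" for \<zeta>
    using that uf(2) uf(4)[OF that] by (simp add: f_def inv_into_f_f)
  note tr = area_pairing_transform[OF \<phi> holomorphic_on_imp_continuous_on[OF fhol] F_f]
  have contF: "continuous_on unit_disc (\<lambda>\<zeta>. F \<zeta> * cnj (deriv \<phi> \<zeta>))"
    by (intro continuous_intros holomorphic_on_imp_continuous_on Fhol uf)
  \<comment> \<open>The dominating function is the kernel bound \<open>1 / (1 - norm z)\<close> times \<open>\<bar>\<phi>'\<bar>\<^sup>2 + 1\<close>, by \<open>t \<le> t\<^sup>2 + 1\<close>. The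
  substitution formula for \<open>f = 1\<close> shows that \<open>\<bar>\<phi>'\<bar>\<^sup>2\<close> is integrable.\<close>
  have int: "set_integrable area unit_disc (\<lambda>\<zeta>. F \<zeta> * cnj (deriv \<phi> \<zeta>))"
  proof (rule set_integrable_bound)
    have "emeasure lborel (\<phi> ` unit_disc) < \<infinity>" using bdd by (rule emeasure_bounded_finite)
    then have "set_integrable lborel (\<phi> ` unit_disc) (\<lambda>_. 1::complex)"
      unfolding set_integrable_def using uf(5)
      by (intro integrable_scaleR_left integrable_real_indicator) auto
    then have "set_integrable area (\<phi> ` unit_disc) (\<lambda>_. 1::complex)"
      by (simp add: area_integral[OF uf(5)])
    then have "set_integrable area unit_disc (\<lambda>\<zeta>. deriv \<phi> \<zeta> * cnj (deriv \<phi> \<zeta>))"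
      using area_pairing_transform(1)[OF \<phi>, of "\<lambda>_. 1" "deriv \<phi>"] by simp
    moreover have "set_integrable area unit_disc (\<lambda>_. 1::complex)"
      by (rule set_integrable_area_cball) simp
    ultimately show "set_integrable area unit_disc (\<lambda>\<zeta>. of_real (1 / (1 - norm z)) * (deriv \<phi> \<zeta> * cnj (deriv \<phi> \<zeta>) + 1))"
      by (intro set_integrable_mult_right set_integral_add(1))
    show "set_borel_measurable area unit_disc (\<lambda>\<zeta>. F \<zeta> * cnj (deriv \<phi> \<zeta>))"
      unfolding set_borel_measurable_def area_def
      using borel_measurable_continuous_on_indicator[OF _ contF] by simp
    show "AE \<zeta> in area. \<zeta> \<in> unit_disc \<longrightarrow> norm (F \<zeta> * cnj (deriv \<phi> \<zeta>)) \<le>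
        norm (of_real (1 / (1 - norm z)) * (deriv \<phi> \<zeta> * cnj (deriv \<phi> \<zeta>) + 1))"
    proof (intro AE_I2 impI)
      fix \<zeta> assume \<zeta>: "\<zeta> \<in> unit_disc"
      have "norm z * norm \<zeta> \<le> norm z * 1" using \<zeta> by (intro mult_left_mono) auto
      then have "1 - norm z \<le> norm (1 - cnj z * \<zeta>)"
        using norm_triangle_ineq2[of 1 "cnj z * \<zeta>"] by (simp add: norm_mult)
      then have F: "norm (F \<zeta>) \<le> 1 / (1 - norm z)"
        unfolding F_def norm_divide using z by (intro frac_le) auto
      define t where "t = norm (deriv \<phi> \<zeta>)"
      have "0 \<le> (t - 1)\<^sup>2" by simp
      then have "2 * t \<le> t\<^sup>2 + 1" unfolding power2_diff by simp
      moreover have "t \<ge> 0" by (simp add: t_def)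
      ultimately have t: "t \<le> t\<^sup>2 + 1" "t \<ge> 0" by linarith+
      have "deriv \<phi> \<zeta> * cnj (deriv \<phi> \<zeta>) + 1 = of_real (t\<^sup>2 + 1)"
        by (simp add: t_def del: of_real_power) (simp add: complex_norm_square[symmetric])
      then have "norm (deriv \<phi> \<zeta> * cnj (deriv \<phi> \<zeta>) + 1) = t\<^sup>2 + 1" 
        by (simp only: norm_of_real) simp
      moreover have "norm (F \<zeta>) * t \<le> 1 / (1 - norm z) * (t\<^sup>2 + 1)"
        using F t z by (intro mult_mono) auto
      ultimately show "norm (F \<zeta> * cnj (deriv \<phi> \<zeta>)) \<le>
          norm (of_real (1 / (1 - norm z)) * (deriv \<phi> \<zeta> * cnj (deriv \<phi> \<zeta>) + 1))"
        unfolding norm_mult[of "F \<zeta>"] norm_mult[of "of_real _"] norm_of_real complex_mod_cnj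
        using z by (simp add: t_def)
    qed
  qed
  have "f \<in> AL1 (\<phi> ` unit_disc)" using fhol tr(1) int by (simp add: AL1_def)
  then have "\<mu> f = (LINT z:\<phi> ` unit_disc|area. f z)" using q by (simp add: quadrature_domain_def)
  also have "\<dots> = (LINT \<zeta>:unit_disc|area. F \<zeta> * cnj (deriv \<phi> \<zeta>))" by (rule tr(2)[OF _ int])
  also have "\<dots> = cnj (\<phi> z)"
  proof (rule LIMSEQ_unique)
    show "(\<lambda>k. LINT \<zeta>:ball 0 (exhaust_radius k)|area. F \<zeta> * cnj (deriv \<phi> \<zeta>)) \<longlonglongrightarrow>
        (LINT \<zeta>:unit_disc|area. F \<zeta> * cnj (deriv \<phi> \<zeta>))"
      unfolding exhaust_radius_def by (rule area_integral_exhaust_disc[OF int])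
    define a where "a = (\<lambda>n. (deriv ^^ n) \<phi> 0 / fact n)"
    have a: "(\<lambda>n. a n * w ^ n) sums \<phi> w" if "norm w < 1" for w
      using holomorphic_power_series[OF uf(1), of w] that by (simp add: a_def)
    have Fs: "(\<lambda>n. cnj z ^ Suc n * w ^ n) sums F w" if "norm w < 1" for w
      unfolding F_def using cauchy_kernel_sums[of "cnj z" w] z that by simp
    have "(LINT \<zeta>:ball 0 (exhaust_radius k)|area. F \<zeta> * cnj (deriv \<phi> \<zeta>)) =
        cnj (\<phi> (of_real ((exhaust_radius k)\<^sup>2) * z))" for k
    proof -
      let ?r = "exhaust_radius k"
      have "(\<lambda>n. a n * (of_real (?r\<^sup>2) * z) ^ n) sums \<phi> (of_real (?r\<^sup>2) * z)"
        using z norm_dilation_le[of k z] by (intro a) simp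
      then have "(\<lambda>n. a (Suc n) * (of_real (?r\<^sup>2) * z) ^ Suc n) sums \<phi> (of_real (?r\<^sup>2) * z)"
        by (subst sums_Suc_iff) (simp add: a_def 0)
      then have "(\<lambda>n. cnj (a (Suc n) * (of_real (?r\<^sup>2) * z) ^ Suc n)) sums cnj (\<phi> (of_real (?r\<^sup>2) * z))"
        by (simp only: sums_cnj)
      moreover have "(\<lambda>n. cnj (a (Suc n) * (of_real (?r\<^sup>2) * z) ^ Suc n)) =
          (\<lambda>n. cnj z ^ Suc n * cnj (a (Suc n)) * of_real (?r\<^sup>2) ^ Suc n)"
        by (simp add: fun_eq_iff power_mult_distrib mult_ac)
      ultimately have "(\<lambda>n. cnj z ^ Suc n * cnj (a (Suc n)) * of_real (?r\<^sup>2) ^ Suc n) sums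
          cnj (\<phi> (of_real (?r\<^sup>2) * z))"
        by (simp only:)
      moreover have "(\<lambda>n. cnj z ^ Suc n * cnj (a (Suc n)) * of_real (?r\<^sup>2) ^ Suc n) sums
          (LINT \<zeta>:ball 0 ?r|area. F \<zeta> * cnj (deriv \<phi> \<zeta>))"
        by (rule area_pairing_deriv[where b="\<lambda>n. cnj z ^ Suc n", OF Fs a exhaust_radius(1,2)])
      ultimately show ?thesis by (rule sums_unique2[rotated])
    qed
    moreover have "(\<lambda>k. cnj (\<phi> (of_real ((exhaust_radius k)\<^sup>2) * z))) \<longlonglongrightarrow> cnj (\<phi> (of_real (1\<^sup>2) * z))"
    proof (intro tendsto_cnj isCont_tendsto_compose[of _ \<phi>])
      show "isCont \<phi> (of_real (1\<^sup>2) * z)"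
        using holomorphic_on_imp_continuous_on[OF uf(1)] z by (simp add: continuous_on_eq_continuous_at)
      show "(\<lambda>k. of_real ((exhaust_radius k)\<^sup>2) * z) \<longlonglongrightarrow> of_real (1\<^sup>2) * z"
        by (intro tendsto_intros exhaust_radius(3))
    qed
    ultimately show "(\<lambda>k. LINT \<zeta>:ball 0 (exhaust_radius k)|area. F \<zeta> * cnj (deriv \<phi> \<zeta>)) \<longlonglongrightarrow> cnj (\<phi> z)"
      by simp
  qed
  finally show "cnj (\<phi> z) = pullback \<phi> \<mu> (\<lambda>\<zeta>. cnj z / (1 - cnj z * \<zeta>) * (1 / deriv \<phi> \<zeta>))"
    by (simp only: pullback_def f_def F_def)
qed

lemma dilation_uniform_limit:
  assumes F: "F holomorphic_on unit_disc" and r: "0 < r" "r < 1"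
  shows "uniform_limit (cball 0 r) (\<lambda>k z. F (of_real ((exhaust_radius k)\<^sup>2) * z)) F sequentially"
proof (rule uniform_limitI)
  fix e :: real assume e: "e > 0"
  have "continuous_on (cball 0 r) F"
    using r by (intro holomorphic_on_imp_continuous_on holomorphic_on_subset[OF F]) auto
  then have "uniformly_continuous_on (cball 0 r) F" by (rule compact_uniformly_continuous) simp
  then obtain d where d: "d > 0" "\<And>x y. x \<in> cball 0 r \<Longrightarrow> y \<in> cball 0 r \<Longrightarrow> dist y x < d \<Longrightarrow> dist (F y) (F x) < e"
    using e unfolding uniformly_continuous_on_def by metis
  have "(\<lambda>k. (exhaust_radius k)\<^sup>2) \<longlonglongrightarrow> 1\<^sup>2" by (intro tendsto_intros exhaust_radius)
  then have "\<forall>\<^sub>F k in sequentially. dist ((exhaust_radius k)\<^sup>2) (1\<^sup>2) < d"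
    using d(1) by (rule tendstoD)
  then show "\<forall>\<^sub>F k in sequentially. \<forall>z\<in>cball 0 r. dist (F (of_real ((exhaust_radius k)\<^sup>2) * z)) (F z) < e"
  proof eventually_elim
    case (elim k)
    let ?s = "(exhaust_radius k)\<^sup>2"
    have s: "0 \<le> ?s" "?s \<le> 1" using exhaust_radius(1,2)[of k] by (auto simp: power_le_one)
    show ?case
    proof
      fix z :: complex assume z: "z \<in> cball 0 r"
      note norm_dilation_le[of k z]
      moreover have "dist (of_real ?s * z) z = norm ((of_real (?s - 1)) * z)"
        by (simp add: dist_norm left_diff_distrib)
      moreover have "norm ((of_real (?s - 1)) * z) = (1 - ?s) * norm z"
        unfolding norm_mult norm_of_real using s by simp
      moreover have "(1 - ?s) * norm z \<le> (1 - ?s) * 1" using s z r by (intro mult_left_mono) auto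
      moreover have "1 - ?s < d" using elim s by (simp add: dist_norm)
      ultimately show "dist (F (of_real ?s * z)) (F z) < e"
        using z by (intro d(2)) auto
    qed
  qed
qed

text \<open>The relation determines the Taylor coefficients of \<open>\<phi>\<close> in terms of \<open>\<nu>\<close>, hence also the pairing of
  any \<open>F\<close> with \<open>\<phi>'\<close> on smaller discs; continuity of \<open>\<nu>\<close> then carries the identity to the unit disc.\<close>

lemma relation_imp_quadrature:
  assumes \<phi>: "univalent_on \<phi> unit_disc" and cc: "compactly_continuous (\<phi> ` unit_disc) \<mu>"
    and rel: "satisfies_relation \<phi> (pullback \<phi> \<mu>)"
  shows "quadrature_domain (\<phi> ` unit_disc) \<mu>"
  unfolding quadrature_domain_def
proof (intro conjI ballI)
  note uf = univalent_on_disc[OF \<phi>]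
  show "complex_domain (\<phi> ` unit_disc)"
    unfolding complex_domain_def using uf(5) holomorphic_on_imp_continuous_on[OF uf(1)]
    by (auto intro: connected_continuous_image)
  fix f assume "f \<in> AL1 (\<phi> ` unit_disc)"
  then have f: "f holomorphic_on \<phi> ` unit_disc" "set_integrable area (\<phi> ` unit_disc) f"
    by (auto simp: AL1_def)
  define \<nu> where "\<nu> = pullback \<phi> \<mu>"
  have cc\<nu>: "compactly_continuous unit_disc \<nu>"
    unfolding \<nu>_def by (rule compactly_continuous_pullback[OF \<phi> cc])
  define p where "p = (\<lambda>\<zeta>. 1 / deriv \<phi> \<zeta>)"
  have p: "p holomorphic_on unit_disc" unfolding p_def by (rule uf(6))
  define c where "c = (\<lambda>n. \<nu> (\<lambda>\<zeta>. \<zeta> ^ n * p \<zeta>))"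
  define a where "a = (\<lambda>n. case n of 0 \<Rightarrow> 0 | Suc n \<Rightarrow> cnj (c n))"
  \<comment> \<open>Expanding the kernel of the relation in powers of \<open>cnj z\<close> exhibits the Taylor series of \<open>\<phi>\<close>.\<close>
  have a: "(\<lambda>n. a n * z ^ n) sums \<phi> z" if z: "norm z < 1" for z
  proof -
    have "(\<lambda>n. cnj z ^ Suc n * c n) sums \<nu> (\<lambda>\<zeta>. cnj z / (1 - cnj z * \<zeta>) * p \<zeta>)"
      unfolding c_def
    proof (rule compactly_continuous_power_series[OF cc\<nu> p])
      show "(\<lambda>\<zeta>. cnj z / (1 - cnj z * \<zeta>)) holomorphic_on unit_disc"
        using one_minus_mult_nonzero[of "cnj z"] z by (intro holomorphic_intros) auto
    qed (use cauchy_kernel_sums[of "cnj z"] z in simp)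
    also have "\<nu> (\<lambda>\<zeta>. cnj z / (1 - cnj z * \<zeta>) * p \<zeta>) = cnj (\<phi> z)"
      using rel z unfolding satisfies_relation_iff[OF \<phi>] p_def \<nu>_def by simp
    finally have "(\<lambda>n. cnj (cnj z ^ Suc n * c n)) sums cnj (cnj (\<phi> z))"
      by (simp only: sums_cnj)
    then have "(\<lambda>n. a (Suc n) * z ^ Suc n) sums \<phi> z"
      by (simp add: a_def mult_ac)
    then show ?thesis by (subst (asm) sums_Suc_iff) (simp add: a_def)
  qed
  define F where "F = (\<lambda>\<zeta>. f (\<phi> \<zeta>) * deriv \<phi> \<zeta>)"
  have F: "F holomorphic_on unit_disc"
    unfolding F_def using holomorphic_on_compose_gen[OF uf(1) f(1)]
    by (intro holomorphic_on_mult uf(3)) (auto simp: comp_def)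
  define b where "b = (\<lambda>n. (deriv ^^ n) F 0 / fact n)"
  have b: "(\<lambda>n. b n * w ^ n) sums F w" if "norm w < 1" for w
    using holomorphic_power_series[OF F, of w] that by (simp add: b_def)
  have F_f: "F \<zeta> = f (\<phi> \<zeta>) * deriv \<phi> \<zeta>" if "\<zeta> \<in> unit_disc" for \<zeta> by (simp add: F_def)
  note tr = area_pairing_transform[OF \<phi> holomorphic_on_imp_continuous_on[OF f(1)], of F, OF F_f]
  have int: "set_integrable area unit_disc (\<lambda>\<zeta>. F \<zeta> * cnj (deriv \<phi> \<zeta>))" using tr(1) f(2) by simp
  \<comment> \<open>The factor \<open>r ^ (2*n+2)\<close> of the pairing is absorbed by the dilation \<open>\<zeta> \<mapsto> r\<^sup>2 * \<zeta>\<close> of \<open>F\<close>.\<close>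
  have disc: "(LINT \<zeta>:ball 0 (exhaust_radius k)|area. F \<zeta> * cnj (deriv \<phi> \<zeta>)) =
     of_real ((exhaust_radius k)\<^sup>2) * \<nu> (\<lambda>\<zeta>. F (of_real ((exhaust_radius k)\<^sup>2) * \<zeta>) * p \<zeta>)" for k
  proof -
    let ?s = "complex_of_real ((exhaust_radius k)\<^sup>2)"
    have s: "norm (?s * w) < 1" if "norm w < 1" for w
      using norm_dilation_le[of k w] that by linarith
    have "(\<lambda>n. (b n * ?s ^ n) * \<nu> (\<lambda>\<zeta>. \<zeta> ^ n * p \<zeta>)) sums \<nu> (\<lambda>\<zeta>. F (?s * \<zeta>) * p \<zeta>)"
    proof (rule compactly_continuous_power_series[OF cc\<nu> p])
      show "(\<lambda>\<zeta>. F (?s * \<zeta>)) holomorphic_on unit_disc"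
        using s by (intro holomorphic_on_compose_gen[OF _ F, unfolded comp_def] holomorphic_intros) auto
      show "(\<lambda>n. b n * ?s ^ n * w ^ n) sums F (?s * w)" if "norm w < 1" for w
        using b[OF s[OF that]] by (simp add: power_mult_distrib mult_ac)
    qed
    from sums_mult[OF this, of ?s]
    have "(\<lambda>n. b n * cnj (a (Suc n)) * ?s ^ Suc n) sums (?s * \<nu> (\<lambda>\<zeta>. F (?s * \<zeta>) * p \<zeta>))"
      by (simp add: a_def c_def mult_ac)
    moreover have "(\<lambda>n. b n * cnj (a (Suc n)) * ?s ^ Suc n) sums
        (LINT \<zeta>:ball 0 (exhaust_radius k)|area. F \<zeta> * cnj (deriv \<phi> \<zeta>))"
      by (rule area_pairing_deriv[where b=b, OF b a exhaust_radius(1,2)])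
    ultimately show ?thesis by (rule sums_unique2[rotated])
  qed
  have "(LINT z:\<phi> ` unit_disc|area. f z) = (LINT \<zeta>:unit_disc|area. F \<zeta> * cnj (deriv \<phi> \<zeta>))"
    by (rule tr(2)[OF _ int])
  also have "\<dots> = \<nu> (\<lambda>\<zeta>. F \<zeta> * p \<zeta>)"
  proof (rule LIMSEQ_unique)
    show "(\<lambda>k. LINT \<zeta>:ball 0 (exhaust_radius k)|area. F \<zeta> * cnj (deriv \<phi> \<zeta>)) \<longlonglongrightarrow>
        (LINT \<zeta>:unit_disc|area. F \<zeta> * cnj (deriv \<phi> \<zeta>))"
      unfolding exhaust_radius_def by (rule area_integral_exhaust_disc[OF int])
    have "(\<lambda>k. \<nu> (\<lambda>\<zeta>. F (of_real ((exhaust_radius k)\<^sup>2) * \<zeta>) * p \<zeta>)) \<longlonglongrightarrow> \<nu> (\<lambda>\<zeta>. F \<zeta> * p \<zeta>)"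
    proof (rule compactly_continuous_tendsto[OF cc\<nu>])
      fix K :: "complex set" assume K: "compact K" "K \<subseteq> unit_disc"
      have "continuous_on K p"
        using p K(2) holomorphic_on_imp_continuous_on continuous_on_subset by blast
      moreover have "uniform_limit K (\<lambda>k \<zeta>. F (of_real ((exhaust_radius k)\<^sup>2) * \<zeta>)) F sequentially"
        by (rule uniform_limit_subset_cball[OF K dilation_uniform_limit[OF F]])
      ultimately show "uniform_limit K (\<lambda>k \<zeta>. F (of_real ((exhaust_radius k)\<^sup>2) * \<zeta>) * p \<zeta>)
          (\<lambda>\<zeta>. F \<zeta> * p \<zeta>) sequentially"
        by (intro uniform_limit_mult_bounded K)
    next
      fix k
      have "norm (of_real ((exhaust_radius k)\<^sup>2) * w) < 1" if "norm w < 1" for w :: complex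
        using norm_dilation_le[of k w] that by linarith
      then show "(\<lambda>\<zeta>. F (of_real ((exhaust_radius k)\<^sup>2) * \<zeta>) * p \<zeta>) holomorphic_on unit_disc"
        by (intro holomorphic_on_mult p holomorphic_on_compose_gen[OF _ F, unfolded comp_def] holomorphic_intros) auto
    qed (intro holomorphic_on_mult F p)
    moreover have "(\<lambda>k. complex_of_real ((exhaust_radius k)\<^sup>2)) \<longlonglongrightarrow> of_real (1\<^sup>2)"
      by (intro tendsto_intros exhaust_radius)
    ultimately have "(\<lambda>k. of_real ((exhaust_radius k)\<^sup>2) * \<nu> (\<lambda>\<zeta>. F (of_real ((exhaust_radius k)\<^sup>2) * \<zeta>) * p \<zeta>))
        \<longlonglongrightarrow> of_real (1\<^sup>2) * \<nu> (\<lambda>\<zeta>. F \<zeta> * p \<zeta>)"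
      by (intro tendsto_mult)
    then show "(\<lambda>k. LINT \<zeta>:ball 0 (exhaust_radius k)|area. F \<zeta> * cnj (deriv \<phi> \<zeta>)) \<longlonglongrightarrow> \<nu> (\<lambda>\<zeta>. F \<zeta> * p \<zeta>)"
      by (simp add: disc)
  qed
  also have "\<dots> = \<mu> f"
    unfolding \<nu>_def pullback_def
  proof (rule compactly_continuous_cong[OF cc holomorphic_comp_inverse[OF \<phi> holomorphic_on_mult[OF F p]] f(1)])
    fix w assume "w \<in> \<phi> ` unit_disc"
    then obtain \<zeta> where "\<zeta> \<in> unit_disc" "w = \<phi> \<zeta>" by blast
    then show "((\<lambda>\<zeta>. F \<zeta> * p \<zeta>) \<circ> inv_into unit_disc \<phi>) w = f w"
      using uf(2) uf(4)[of \<zeta>] by (simp add: inv_into_f_f F_def p_def)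
  qed
  finally show "(LINT z:\<phi> ` unit_disc|area. f z) = \<mu> f" .
qed

theorem theorem1p2:
  shows "(\<forall>\<Omega> \<mu> \<phi>.
            solid_domain \<Omega> \<and> 0 \<in> \<Omega> \<and> compactly_supported_functional \<Omega> \<mu> \<and>
            quadrature_domain \<Omega> \<mu> \<and> normalized_conformal_map \<phi> \<Omega> \<longrightarrow>
            satisfies_relation \<phi> (pullback \<phi> \<mu>)) \<and>
         (\<forall>\<phi> \<mu>.
            univalent_on \<phi> unit_disc \<and>
            compactly_supported_functional (\<phi> ` unit_disc) \<mu> \<and>
            satisfies_relation \<phi> (pullback \<phi> \<mu>) \<longrightarrow>
            quadrature_domain (\<phi> ` unit_disc) \<mu>)"
proof (intro conjI allI impI; elim conjE)
  fix \<Omega> \<mu> \<phi>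
  assume "solid_domain \<Omega>" "quadrature_domain \<Omega> \<mu>" "normalized_conformal_map \<phi> \<Omega>"
  then show "satisfies_relation \<phi> (pullback \<phi> \<mu>)"
    unfolding solid_domain_def normalized_conformal_map_def by (blast intro: quadrature_imp_relation)
next
  fix \<mu> \<phi>
  assume \<phi>: "univalent_on \<phi> unit_disc" and \<mu>: "compactly_supported_functional (\<phi> ` unit_disc) \<mu>"
    and rel: "satisfies_relation \<phi> (pullback \<phi> \<mu>)"
  from \<mu> have "compactly_continuous (\<phi> ` unit_disc) \<mu>"
    unfolding compactly_supported_functional_def
    using given_by_measure_compactly_continuous
      given_by_distribution_compactly_continuous[OF univalent_on_disc(5)[OF \<phi>]] by blast
  then show "quadrature_domain (\<phi> ` unit_disc) \<mu>" by (rule relation_imp_quadrature[OF \<phi> _ rel])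
qed

end
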